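(* Let $D\subseteq\mathbb{R}^n$, $x_0\in D$ and $F:D\to\mathbb{R}^m$ satisfy the Standing Assumption (i)--(v) of the context with constants $\delta_0>0$ and $\eta\in(0,\tfrac12)$, and let $x_*$ be the unique $x_0$-minimum-norm solution of $F(x)=0$. Assume $\ker(F'(x_* ))\subseteq\ker(F'(x))$ for all $x\in B_{\delta_0/2}(x_* )$. Let $\{x_k\}_{k\ge 0}$ be the sequence generated by Algorithm A (see context), and assume $\Delta_k\neq0$ for all $k\ge 1$. Let $$\varepsilon_0=\frac{-\eta(1+\eta^2)+\sqrt{\eta^2(1+\eta^2)^2+(1+\eta^2)(1-2\eta^2-4\eta^3)}}{1-2\eta^2-4\eta^3}.$$ Assume that there exists $\gamma\in(\varepsilon_0/2,\varepsilon_0)$ such that the following conditions hold for all $k$ (for which the quantities are defined): (C1) $\kappa(F'_{\mathcal{J}_k}(x_k))\le K$ for some constant $K\in[1,C_1(\eta,\gamma))$; (C2) $\beta_k\in(0,\beta_{\max})$ for some constant $\beta_{\max}\in(0,C_2(\eta,\gamma))$; (C3) $\sin^2\theta_k\le\gamma$; where $$C_1(\eta,\gamma)=\sqrt{\frac{(1-2\eta\gamma)(1+\eta^2)}{(1-2\eta^2-4\eta^3)\gamma^2}},$$ $$C_2(\eta,\gamma)=\min\left\{\frac{\sqrt{(1+3d^2)^2+8(1+d^2)(d^4+d^2c-d^2)}-(1+3d^2)}{4(1+d^2)},\ \frac{\sqrt{1+c}-1}{2}\right\},$$ $$c=\frac{1-2\eta\gamma}{(1+\eta^2)K^2\gamma^2},\qquad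 d=1-\frac{1-2\eta}{1+\eta^2}.$$ Then: (i) $\{x_k\}\subseteq B_{\delta_0/2}(x_* )\subseteq B_{\delta_0}(x_0)$. (ii) If $F(x_k)\ne0$ for some $k$, then $x_{k+1}-x_*\in\ker(F'(x_* ))^\perp$ and $$\|x_{k+1}-x_*\|_2^2\le q^k(1+\xi)\|x_0-x_*\|_2^2,$$ where $$q=\frac{b_1+\sqrt{b_1^2+4b_2}}{2},\quad \xi=q-b_1,\quad b_1=1+3\beta_{\max}+2\beta_{\max}^2-\frac{1-2\eta\gamma}{(1+\eta^2)K^2\gamma^2},\quad b_2=2\beta_{\max}^2+\beta_{\max}.$$ Furthermore, $q<d^2<1$.
   Context: Notation. $F=(F_1,\dots,F_m)^{\mathsf T}$; $F'(x)$ is the Jacobian of $F$ at $x$, with $i$-th row $\nabla F_i(x)^{\mathsf T}$. For $\mathcal{J}\subseteq\{1,\dots,m\}$, $F_{\mathcal{J}}(x)$ and $F'_{\mathcal{J}}(x)$ are the subvector of $F(x)$ and the row submatrix of $F'(x)$ indexed by $\mathcal{J}$. $B_r(x)$ is the closed ball of radius $r$ about $x$ in the Euclidean norm. For a matrix $A\neq0$, $\sigma_{\max}(A)$ and $\sigma_{\min}(A)$ are its largest and its smallest nonzero singular values, and $\kappa(A)=\sigma_{\max}(A)/\sigma_{\min}(A)$. For the nonlinear map $F$, $\ker(F)$ denotes the zero set $\{x\in D: F(x)=0\}$; for the matrix $F'(x)$ it is the null space. Standing Assumption. $D\subseteq\mathbb{R}^n$ is a bounded closed domain, $x_0\in D$,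 $F:D\to\mathbb{R}^m$, and: (i) each $F_i:D\to\mathbb{R}$ is differentiable; (ii) there exists $\delta_0>0$ such that $B_{\delta_0}(x_0)\subseteq D$; (iii) for each $i$ there is a constant $\eta_i\ge0$ such that for all $x,\tilde x\in B_{\delta_0}(x_0)$, $|F_i(x)-F_i(\tilde x)-\nabla F_i(x)^{\mathsf T}(x-\tilde x)|\le\eta_i|F_i(x)-F_i(\tilde x)|$, and $\eta=\max_{1\le i\le m}\eta_i<\tfrac12$; (iv) $B_{\delta_0/4}(x_0)\cap\ker(F)\ne\emptyset$; (v) there exists $\tilde x\in B_{\delta_0}(x_0)$ such that $F'(\tilde x)^{\mathsf T}e_i\ne0$ for all $i\in\{1,\dots,m\}$, where $e_1,\dots,e_m$ is the standard basis of $\mathbb{R}^m$. Under these assumptions there is a unique element $x_*$ of $\ker(F)\cap B_{\delta_0}(x_0)$ closest to $x_0$ (the $x_0$-minimum-norm solution). Algorithm A (average block nonlinear Kaczmarz method with adaptive momentum). Fix $\theta\in(0,1]$. At each $k\ge0$ let $$\mathcal{J}_k=\{i: |F_i(x_k)|^2\ge\theta\max_{1\le j\le m}|F_j(x_k)|^2\},\qquad g_k=(F'_{\mathcal{J}_k}(x_k))^{\mathsf T}F_{\mathcal{J}_k}(x_k).$$ The first step is $x_1=x_0-\frac{\|F_{\mathcal{J}_0}(x_0)\|_2^2}{\|g_0\|_2^2}g_0$. For $k\ge1$, $$x_{k+1}=x_k-\alpha_k\frac{g_k}{\|F'_{\mathcal{J}_k}(x_k)\|^2}+\beta_k(x_k-x_{k-1}),$$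 where $\|F'_{\mathcal{J}_k}(x_k)\|^2=\sum_{i\in\mathcal{J}_k}\|\nabla F_i(x_k)\|_2^2$ and $$\alpha_k=\frac{\|x_k-x_{k-1}\|_2^2\|F_{\mathcal{J}_k}(x_k)\|_2^2\|F'_{\mathcal{J}_k}(x_k)\|^2}{\Delta_k},\qquad \beta_k=\frac{\langle x_k-x_{k-1},g_k\rangle\|F_{\mathcal{J}_k}(x_k)\|_2^2}{\Delta_k},$$ $$\Delta_k=\|g_k\|_2^2\|x_k-x_{k-1}\|_2^2-\langle g_k,x_k-x_{k-1}\rangle^2 .$$ The stopping test is disregarded. The angle is $\theta_k=\arccos\left(\frac{\langle g_k,x_k-x_{k-1}\rangle}{\|g_k\|_2\|x_k-x_{k-1}\|_2}\right)$, $k\ge1$. *)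

theory Defs
  imports "HOL-Analysis.Analysis"
begin

(* Closure of a domain in the sense of analysis (nonempty open connected set). *)
definition closed_domain :: "'a::topological_space set \<Rightarrow> bool" where
  "closed_domain D \<longleftrightarrow> (\<exists>U. open U \<and> connected U \<and> U \<noteq> {} \<and> D = closure U)"

definition zero_set :: "'a set \<Rightarrow> ('a \<Rightarrow> real ^ 'm) \<Rightarrow> 'a set" where
  "zero_set D F = {x \<in> D. F x = 0}"

definition null_space :: "real ^ 'n ^ 'm \<Rightarrow> (real ^ 'n) set" where
  "null_space A = {v. A *v v = 0}"

(* Element of ker(F) in the closed ball of radius r about x0 that is closest to x0.
   Uniqueness is not part of the definition; it follows from the tangential cone condition. *)
definition min_norm_solution ::
  "(real ^ 'n) set \<Rightarrow> (real ^ 'n \<Rightarrow> real ^ 'm) \<Rightarrow> real ^ 'n \<Rightarrow> real \<Rightarrow> real ^ 'n \<Rightarrow> bool" where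
  "min_norm_solution D F x0 r xs \<longleftrightarrow>
     xs \<in> zero_set D F \<inter> cball x0 r \<and>
     (\<forall>y \<in> zero_set D F \<inter> cball x0 r. norm (xs - x0) \<le> norm (y - x0))"

(* Singular values as square roots of the eigenvalues of the n x n matrix A^T A. Compared with
   the convention of min(m,n) singular values this can only add the value 0, which affects
   neither the largest singular value of A \<noteq> 0 nor the smallest nonzero one. *)
definition singular_values :: "real ^ 'n ^ 'm \<Rightarrow> real set" where
  "singular_values A =
     {s. 0 \<le> s \<and> (\<exists>v. v \<noteq> 0 \<and> (transpose A ** A) *v v = s\<^sup>2 *\<^sub>R v)}"

definition sigma_max :: "real ^ 'n ^ 'm \<Rightarrow> real" where
  "sigma_max A = Max (singular_values A)"

definition sigma_min :: "real ^ 'n ^ 'm \<Rightarrow> real" where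
  "sigma_min A = Min (singular_values A - {0})"

definition kappa :: "real ^ 'n ^ 'm \<Rightarrow> real" where
  "kappa A = sigma_max A / sigma_min A"

(* The subvector and the row submatrix indexed by J keep the full index type, with the entries
   (rows) outside J set to 0. For v_J and A_J this changes neither the norms, nor the products
   A_J^T v_J and A_J^T A_J, hence not the nonzero singular values. *)
definition subvector :: "'m set \<Rightarrow> real ^ 'm \<Rightarrow> real ^ 'm" where
  "subvector J v = (\<chi> i. if i \<in> J then v $ i else 0)"

definition row_submatrix :: "'m set \<Rightarrow> real ^ 'n ^ 'm \<Rightarrow> real ^ 'n ^ 'm" where
  "row_submatrix J A = (\<chi> i. if i \<in> J then A $ i else 0)"

(* In the following, y is the current iterate x_k, z the previous iterate x_(k-1),
   and F' the Jacobian as a function of the point. *)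

definition block_set :: "real \<Rightarrow> (real ^ 'n \<Rightarrow> real ^ 'm) \<Rightarrow> real ^ 'n \<Rightarrow> 'm set" where
  "block_set \<theta> F y = {i. \<bar>F y $ i\<bar>\<^sup>2 \<ge> \<theta> * (MAX j. \<bar>F y $ j\<bar>\<^sup>2)}"

definition block_F :: "real \<Rightarrow> (real ^ 'n \<Rightarrow> real ^ 'm) \<Rightarrow> real ^ 'n \<Rightarrow> real ^ 'm" where
  "block_F \<theta> F y = subvector (block_set \<theta> F y) (F y)"

definition block_jac ::
  "real \<Rightarrow> (real ^ 'n \<Rightarrow> real ^ 'm) \<Rightarrow> (real ^ 'n \<Rightarrow> real ^ 'n ^ 'm) \<Rightarrow> real ^ 'n \<Rightarrow> real ^ 'n ^ 'm" where
  "block_jac \<theta> F F' y = row_submatrix (block_set \<theta> F y) (F' y)"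

definition block_grad ::
  "real \<Rightarrow> (real ^ 'n \<Rightarrow> real ^ 'm) \<Rightarrow> (real ^ 'n \<Rightarrow> real ^ 'n ^ 'm) \<Rightarrow> real ^ 'n \<Rightarrow> real ^ 'n" where
  "block_grad \<theta> F F' y = transpose (block_jac \<theta> F F' y) *v block_F \<theta> F y"

definition block_jac_norm2 ::
  "real \<Rightarrow> (real ^ 'n \<Rightarrow> real ^ 'm) \<Rightarrow> (real ^ 'n \<Rightarrow> real ^ 'n ^ 'm) \<Rightarrow> real ^ 'n \<Rightarrow> real" where
  "block_jac_norm2 \<theta> F F' y = (\<Sum>i\<in>block_set \<theta> F y. (norm (F' y $ i))\<^sup>2)"

definition mom_Delta ::
  "real \<Rightarrow> (real ^ 'n \<Rightarrow> real ^ 'm) \<Rightarrow> (real ^ 'n \<Rightarrow> real ^ 'n ^ 'm) \<Rightarrow> real ^ 'n \<Rightarrow> real ^ 'n \<Rightarrow> real" where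
  "mom_Delta \<theta> F F' y z =
     (norm (block_grad \<theta> F F' y))\<^sup>2 * (norm (y - z))\<^sup>2 - (block_grad \<theta> F F' y \<bullet> (y - z))\<^sup>2"

definition mom_alpha ::
  "real \<Rightarrow> (real ^ 'n \<Rightarrow> real ^ 'm) \<Rightarrow> (real ^ 'n \<Rightarrow> real ^ 'n ^ 'm) \<Rightarrow> real ^ 'n \<Rightarrow> real ^ 'n \<Rightarrow> real" where
  "mom_alpha \<theta> F F' y z =
     (norm (y - z))\<^sup>2 * (norm (block_F \<theta> F y))\<^sup>2 * block_jac_norm2 \<theta> F F' y / mom_Delta \<theta> F F' y z"

definition mom_beta ::
  "real \<Rightarrow> (real ^ 'n \<Rightarrow> real ^ 'm) \<Rightarrow> (real ^ 'n \<Rightarrow> real ^ 'n ^ 'm) \<Rightarrow> real ^ 'n \<Rightarrow> real ^ 'n \<Rightarrow> real" where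
  "mom_beta \<theta> F F' y z =
     ((y - z) \<bullet> block_grad \<theta> F F' y) * (norm (block_F \<theta> F y))\<^sup>2 / mom_Delta \<theta> F F' y z"

definition mom_angle ::
  "real \<Rightarrow> (real ^ 'n \<Rightarrow> real ^ 'm) \<Rightarrow> (real ^ 'n \<Rightarrow> real ^ 'n ^ 'm) \<Rightarrow> real ^ 'n \<Rightarrow> real ^ 'n \<Rightarrow> real" where
  "mom_angle \<theta> F F' y z =
     arccos ((block_grad \<theta> F F' y \<bullet> (y - z)) / (norm (block_grad \<theta> F F' y) * norm (y - z)))"

(* x is the infinite sequence of iterates (no stopping test) started at x0. *)
definition algorithm_A ::
  "real \<Rightarrow> (real ^ 'n \<Rightarrow> real ^ 'm) \<Rightarrow> (real ^ 'n \<Rightarrow> real ^ 'n ^ 'm) \<Rightarrow> real ^ 'n \<Rightarrow>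
   (nat \<Rightarrow> real ^ 'n) \<Rightarrow> bool" where
  "algorithm_A \<theta> F F' x0 x \<longleftrightarrow>
     x 0 = x0 \<and>
     x 1 = x0 - ((norm (block_F \<theta> F x0))\<^sup>2 / (norm (block_grad \<theta> F F' x0))\<^sup>2) *\<^sub>R block_grad \<theta> F F' x0 \<and>
     (\<forall>k\<ge>1. x (k + 1) =
        x k
        - mom_alpha \<theta> F F' (x k) (x (k - 1)) *\<^sub>R
            ((1 / block_jac_norm2 \<theta> F F' (x k)) *\<^sub>R block_grad \<theta> F F' (x k))
        + mom_beta \<theta> F F' (x k) (x (k - 1)) *\<^sub>R (x k - x (k - 1)))"

definition eps0 :: "real \<Rightarrow> real" where
  "eps0 \<eta> =
     (- \<eta> * (1 + \<eta>^2) + sqrt (\<eta>^2 * (1 + \<eta>^2)^2 + (1 + \<eta>^2) * (1 - 2 * \<eta>^2 - 4 * \<eta>^3)))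
     / (1 - 2 * \<eta>^2 - 4 * \<eta>^3)"

definition C1 :: "real \<Rightarrow> real \<Rightarrow> real" where
  "C1 \<eta> \<gamma> = sqrt ((1 - 2 * \<eta> * \<gamma>) * (1 + \<eta>^2) / ((1 - 2 * \<eta>^2 - 4 * \<eta>^3) * \<gamma>^2))"

definition c_const :: "real \<Rightarrow> real \<Rightarrow> real \<Rightarrow> real" where
  "c_const \<eta> \<gamma> K = (1 - 2 * \<eta> * \<gamma>) / ((1 + \<eta>^2) * K^2 * \<gamma>^2)"

definition d_const :: "real \<Rightarrow> real" where
  "d_const \<eta> = 1 - (1 - 2 * \<eta>) / (1 + \<eta>^2)"

(* Depends on K through the constant c. *)
definition C2 :: "real \<Rightarrow> real \<Rightarrow> real \<Rightarrow> real" where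
  "C2 \<eta> \<gamma> K =
     (let c = c_const \<eta> \<gamma> K; d = d_const \<eta> in
      min ((sqrt ((1 + 3 * d^2)^2 + 8 * (1 + d^2) * (d^4 + d^2 * c - d^2)) - (1 + 3 * d^2))
             / (4 * (1 + d^2)))
          ((sqrt (1 + c) - 1) / 2))"

definition b1 :: "real \<Rightarrow> real \<Rightarrow> real \<Rightarrow> real \<Rightarrow> real" where
  "b1 \<eta> \<gamma> K \<beta> = 1 + 3 * \<beta> + 2 * \<beta>^2 - (1 - 2 * \<eta> * \<gamma>) / ((1 + \<eta>^2) * K^2 * \<gamma>^2)"

definition b2 :: "real \<Rightarrow> real" where
  "b2 \<beta> = 2 * \<beta>^2 + \<beta>"

definition q_rate :: "real \<Rightarrow> real \<Rightarrow> real \<Rightarrow> real \<Rightarrow> real" where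
  "q_rate \<eta> \<gamma> K \<beta> = (b1 \<eta> \<gamma> K \<beta> + sqrt ((b1 \<eta> \<gamma> K \<beta>)^2 + 4 * b2 \<beta>)) / 2"

definition xi :: "real \<Rightarrow> real \<Rightarrow> real \<Rightarrow> real \<Rightarrow> real" where
  "xi \<eta> \<gamma> K \<beta> = q_rate \<eta> \<gamma> K \<beta> - b1 \<eta> \<gamma> K \<beta>"

end

theory Submission
  imports Defs
begin

text \<open>
  Put \<open>u\<^sub>k = x\<^sub>k\<^sub>+\<^sub>1 - x\<^sub>k\<close>. The momentum coefficients make \<open>u\<^sub>k\<close> orthogonal to \<open>u\<^sub>k\<^sub>-\<^sub>1\<close>, with
  \<open>norm u\<^sub>k = \<beta>\<^sub>k tan \<theta>\<^sub>k norm u\<^sub>k\<^sub>-\<^sub>1\<close>. Hence (C2) and (C3) bound the squared step lengths by a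
  geometric sequence of ratio \<open>y = \<beta>max\<^sup>2 \<gamma> / (1 - \<gamma>)\<close>, and the form of \<open>C2\<close> forces
  \<open>y \<le> 29/200\<close>. Since the first step does not increase the distance to \<open>xs\<close>, all iterates stay
  in the ball. They converge; the limit is a zero of \<open>F\<close>, and it is \<open>xs\<close> because all errors are
  orthogonal to the null space of \<open>F' xs\<close>. Thus the error at step \<open>k\<close> is the tail sum of the
  \<open>u\<^sub>j\<close>, \<open>j \<ge> k\<close>, which gives squared errors contracting with ratio \<open>y (1 + y) / (1 - y)\<^sup>3 \<le> q\<close>.
  A lower bound for \<open>F' (x\<^sub>k)\<close> by its smallest nonzero singular value is deliberately avoided:
  the errors need not be orthogonal to the null space of the selected row block.
\<close>

section \<open>Scalar estimates for \<eta>, \<gamma>, c, d and the momentum bound\<close>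

text \<open>\<open>eps0 \<eta>\<close> is the positive root of
  \<open>A * t^2 + 2 * p * t - c\<close>, so each bound amounts to the sign of this quadratic at 6/7
  or at 1. The value 6/7 is what yields \<open>\<gamma> > 3/7\<close>, that is,
  \<open>1 / \<gamma> - 1 < 4/3\<close>.\<close>

lemma eps0_bounds:
  assumes "0 < \<eta>" "\<eta> < 1/2"
  shows "6/7 < eps0 \<eta>" "eps0 \<eta> \<le> 1"
proof -
  define A p c where "A = 1 - 2 * \<eta>^2 - 4 * \<eta>^3" and "p = \<eta> * (1 + \<eta>^2)" and "c = 1 + \<eta>^2"
  note defs = A_def p_def c_def
  have "A = (1 - 2 * \<eta>) * (1 + 2 * \<eta> + 2 * \<eta>^2)"
    unfolding defs by (simp add: algebra_simps power2_eq_square power3_eq_cube)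
  then have A: "A > 0" using assms by (simp add: add_pos_nonneg)
  have p: "p > 0" "c > 0" using assms by (auto simp: defs add_pos_nonneg)
  have eps: "eps0 \<eta> = (- p + sqrt (p^2 + c * A)) / A"
    unfolding eps0_def defs by (simp add: power_mult_distrib)
  \<comment> \<open>tangent (double-root) form of the cubic near its minimum\<close>
  have "49 * c - 36 * A - 84 * p = 60 * ((\<eta> - 57/200)^2 * (\<eta> + 57/100))
      + 121 * (\<eta> - 287/1000)^2 + 255456/1000000 + 745/10000 * \<eta>"
    unfolding defs by (simp add: power2_eq_square power3_eq_cube field_simps)
  moreover have "0 \<le> (\<eta> - 57/200)^2 * (\<eta> + 57/100)" using assms by simp
  moreover have "0 \<le> (\<eta> - 287/1000)^2" by simp
  ultimately have "36 * A + 84 * p < 49 * c" using assms(1) by linarith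
  then have "A * (36 * A + 84 * p) < A * (49 * c)" using A by simp
  then have "(6/7 * A + p)^2 < p^2 + c * A"
    by (simp add: power2_eq_square algebra_simps)
  then have "6/7 * A + p < sqrt (p^2 + c * A)" by (rule real_less_rsqrt)
  then show "6/7 < eps0 \<eta>" using A by (simp add: eps field_simps)
  have "0 \<le> \<eta> * ((1 - 2 * \<eta>) * (2 + \<eta>))" using assms by simp
  then have "c \<le> A + 2 * p"
    unfolding defs by (simp add: algebra_simps power2_eq_square power3_eq_cube)
  then have "A * c \<le> A * (A + 2 * p)" using A by simp
  then have "p^2 + c * A \<le> (A + p)^2"
    by (simp add: power2_eq_square algebra_simps)
  then have "sqrt (p^2 + c * A) \<le> A + p" using A p by (intro real_le_lsqrt) auto
  then show "eps0 \<eta> \<le> 1" using A by (simp add: eps field_simps)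
qed

lemma d_const_bounds:
  assumes "0 < \<eta>" "\<eta> < 1/2"
  shows "0 < d_const \<eta>" "d_const \<eta> < 1"
proof -
  have pos: "0 < 1 + \<eta>^2" by (simp add: add_pos_nonneg)
  have "d_const \<eta> = (2 * \<eta> + \<eta>^2) / (1 + \<eta>^2)"
    unfolding d_const_def using pos by (simp add: field_simps)
  then show "0 < d_const \<eta>" using assms pos by (simp add: add_pos_nonneg)
  show "d_const \<eta> < 1" using assms pos by (simp add: d_const_def)
qed

text \<open>The worst case is \<open>K = 1\<close>, where c is \<open>(1 + v)^2\<close> times an
  expression in \<eta>. That expression splits into \<open>1 - d\<close> and a multiple of
  \<open>s\<close>, and \<open>s\<close> is bounded through d. Only v and d survive, and these are
  the variables in which \<open>C2\<close> is then estimated.\<close>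

lemma c_const_le:
  assumes "0 < \<eta>" "\<eta> < 1/2" "0 < v" "v \<le> 4/3" "\<gamma> = 1 / (1 + v)" "1 \<le> K"
  defines "d \<equiv> d_const \<eta>"
  shows "c_const \<eta> \<gamma> K - 1 + d^2 \<le> 2 * v + v^2 - d * (6 * v + v^2) / 5"
proof -
  have d: "0 < d" "d < 1" using d_const_bounds assms by auto
  have pos: "0 < 1 + \<eta>^2" by (simp add: add_pos_nonneg)
  define s where "s = 2 * \<eta> / (1 + \<eta>^2)"
  have d_eq: "d = (2 * \<eta> + \<eta>^2) / (1 + \<eta>^2)"
    unfolding d_def d_const_def using pos by (simp add: field_simps)
  \<comment> \<open>Up to positive factors this is \<open>(1 - 2 * \<eta>)^2 \<ge> 0\<close>, so the
    constant 1/5 is sharp at the end \<open>\<eta> = 1/2\<close>.\<close>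
  have "d^2 / 5 \<le> \<eta>^2 / (1 + \<eta>^2)"
  proof -
    have "(2 + \<eta>)^2 \<le> 5 * (1 + \<eta>^2)"
      using zero_le_power2[of "1 - 2 * \<eta>"] by (simp add: power2_eq_square algebra_simps)
    then have "\<eta>^2 * (2 + \<eta>)^2 \<le> \<eta>^2 * (5 * (1 + \<eta>^2))" by (rule mult_left_mono) simp
    moreover have "(2 * \<eta> + \<eta>^2)^2 = \<eta>^2 * (2 + \<eta>)^2"
      by (simp add: power2_eq_square algebra_simps)
    ultimately have "(2 * \<eta> + \<eta>^2)^2 \<le> 5 * \<eta>^2 * (1 + \<eta>^2)" by (simp add: algebra_simps)
    then have "(2 * \<eta> + \<eta>^2)^2 / (1 + \<eta>^2)^2 \<le> 5 * \<eta>^2 * (1 + \<eta>^2) / (1 + \<eta>^2)^2"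
      by (rule divide_right_mono) simp
    also have "\<dots> = 5 * \<eta>^2 / (1 + \<eta>^2)"
      using pos by (simp add: power2_eq_square)
    finally show ?thesis by (simp add: d_eq power_divide)
  qed
  moreover have "s = d - \<eta>^2 / (1 + \<eta>^2)"
    unfolding s_def d_eq by (simp add: add_divide_distrib)
  ultimately have s: "s \<le> d - d^2 / 5" by simp
  have g: "0 < \<gamma>" "\<gamma> < 1" using assms by auto
  have "2 * \<eta> * \<gamma> \<le> 2 * \<eta>" using g assms(1) by (intro mult_left_le) auto
  then have nn: "0 \<le> 1 - 2 * \<eta> * \<gamma>" using assms by linarith
  have "(1 + \<eta>^2) * \<gamma>^2 * 1 \<le> (1 + \<eta>^2) * \<gamma>^2 * K^2"
    using assms pos by (intro mult_left_mono) (auto simp: one_le_power)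
  then have "c_const \<eta> \<gamma> K \<le> (1 - 2 * \<eta> * \<gamma>) / ((1 + \<eta>^2) * \<gamma>^2)"
    unfolding c_const_def using nn pos g assms(6)
    by (intro divide_left_mono) (auto simp: mult_ac intro!: mult_pos_pos)
  also have "\<dots> = (1 + v)^2 * ((1 - 2 * \<eta> * \<gamma>) / (1 + \<eta>^2))"
    using g assms(3) unfolding assms(5) by (simp add: power_divide)
  also have "(1 - 2 * \<eta> * \<gamma>) / (1 + \<eta>^2) = 1 - d + (1 - \<gamma>) * s"
    unfolding d_def d_const_def s_def by (simp add: diff_divide_distrib algebra_simps)
  also have "(1 + v)^2 * (1 - d + (1 - \<gamma>) * s) = (1 + v)^2 * (1 - d) + v * (1 + v) * s"
    unfolding assms(5) using \<open>0 < v\<close> by (simp add: field_simps power2_eq_square)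
  also have "\<dots> \<le> (1 + v)^2 * (1 - d) + v * (1 + v) * (d - d^2 / 5)"
    using s \<open>0 < v\<close> by (intro add_left_mono mult_left_mono) auto
  finally have 1: "c_const \<eta> \<gamma> K \<le> (1 + v)^2 * (1 - d) + v * (1 + v) * (d - d^2 / 5)" .
  have "v * v \<le> 4/3 * (4/3)" using assms by (intro mult_mono) auto
  \<comment> \<open>The collected coefficient of \<open>d^2\<close> is nonnegative for
    \<open>v \<le> 4/3\<close>, so there \<open>d^2\<close> may be replaced by the larger d.\<close>
  then have "0 \<le> 1 - v * (1 + v) / 5" using assms by (simp add: algebra_simps)
  then have "d * d * (1 - v * (1 + v) / 5) \<le> d * 1 * (1 - v * (1 + v) / 5)"
    using d by (intro mult_right_mono mult_left_mono) auto
  with 1 show ?thesis by (simp add: power2_eq_square field_simps)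
qed

text \<open>The first entry of the minimum in \<open>C2\<close> is the larger root of a quadratic in
  \<beta> whose discriminant is \<open>X\<close>, and \<beta> lies below that root. Rearranged, the
  inequality says that \<open>z^2 - b1 * z - b2\<close> is positive at
  \<open>z = d^2\<close>.\<close>

lemma less_C2D:
  assumes "0 < \<beta>" "\<beta> < C2 \<eta> \<gamma> K"
  defines "d \<equiv> d_const \<eta>" and "c \<equiv> c_const \<eta> \<gamma> K"
  shows "2 * \<beta>^2 + \<beta> + d^2 * (3 * \<beta> + 2 * \<beta>^2) < d^2 * (c - 1 + d^2)"
proof -
  define X where "X = (1 + 3 * d^2)^2 + 8 * (1 + d^2) * (d^4 + d^2 * c - d^2)"
  have pos: "0 < 1 + d^2" by (simp add: add_pos_nonneg)
  have "\<beta> < (sqrt X - (1 + 3 * d^2)) / (4 * (1 + d^2))"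
    using assms(2) unfolding C2_def Let_def X_def d_def c_def by simp
  then have "4 * (1 + d^2) * \<beta> + (1 + 3 * d^2) < sqrt X"
    using pos by (simp add: pos_less_divide_eq mult_ac)
  moreover have "0 \<le> 4 * (1 + d^2) * \<beta> + (1 + 3 * d^2)"
    using assms(1) by simp
  ultimately have "(4 * (1 + d^2) * \<beta> + (1 + 3 * d^2))^2 < X"
    by (meson not_less real_le_lsqrt)
  then have "(8 * (1 + d^2)) * (2 * \<beta>^2 + \<beta> + d^2 * (3 * \<beta> + 2 * \<beta>^2))
      < (8 * (1 + d^2)) * (d^2 * (c - 1 + d^2))"
    unfolding X_def by (simp add: power2_eq_square power4_eq_xxxx algebra_simps)
  moreover have "0 < 8 * (1 + d^2)" using pos by simp
  ultimately show ?thesis by (simp only: mult_less_cancel_left_pos)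
qed

text \<open>The second bound limits the ratio \<open>\<beta>^2 / v\<close> of squared step lengths,
  on which all later estimates rest. The first is cruder and serves to keep
  \<open>\<beta> / v\<close> below 5/6.\<close>

lemma momentum_bounds:
  assumes "0 < \<eta>" "\<eta> < 1/2" "0 < v" "v \<le> 4/3" "\<gamma> = 1 / (1 + v)" "1 \<le> K"
    and "0 < \<beta>" "\<beta> < C2 \<eta> \<gamma> K"
  shows "4 * \<beta> \<le> 2 * v + v^2" and "\<beta>^2 \<le> 29/200 * v"
proof -
  define d where "d = d_const \<eta>"
  have d: "0 < d" "d < 1" using d_const_bounds assms by (auto simp: d_def)
  then have D: "0 < d^2" "d^2 < 1" by (auto simp: power_less_one_iff)
  have "d^2 * (c_const \<eta> \<gamma> K - 1 + d^2) \<le> d^2 * (2 * v + v^2 - d * (6 * v + v^2) / 5)"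
    using c_const_le[OF assms(1-6)] D unfolding d_def by (intro mult_left_mono) auto
  with less_C2D[OF assms(7,8)]
  have main: "2 * \<beta>^2 + \<beta> + d^2 * (3 * \<beta> + 2 * \<beta>^2)
      < d^2 * (2 * v + v^2 - d * (6 * v + v^2) / 5)"
    unfolding d_def by linarith
  show "4 * \<beta> \<le> 2 * v + v^2"
  proof -
    have "d^2 * (2 * v + v^2 - d * (6 * v + v^2) / 5) \<le> d^2 * (2 * v + v^2)"
      using d assms(3) by (intro mult_left_mono) auto
    moreover have "d^2 * \<beta> \<le> 1 * \<beta>" using D assms(7) by (intro mult_right_mono) auto
    moreover have "d^2 * (3 * \<beta>) \<le> d^2 * (3 * \<beta> + 2 * \<beta>^2)"
      by (intro mult_left_mono) auto
    moreover have "0 \<le> \<beta>^2" by simp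
    ultimately have "d^2 * (4 * \<beta>) < d^2 * (2 * v + v^2)"
      using main by linarith
    then show ?thesis using D by simp
  qed
  show "\<beta>^2 \<le> 29/200 * v"
  proof (rule ccontr)
    assume "\<not> \<beta>^2 \<le> 29/200 * v"
    \<comment> \<open>The left side of \<open>main\<close> increases with \<beta>, so
      \<open>main\<close> persists at the smaller value \<open>b\<close>, where v can be eliminated
      in favour of \<open>b^2\<close>.\<close>
    define b where "b = sqrt (29/200 * v)"
    have b: "0 < b" "b^2 = 29/200 * v" using assms(3) by (auto simp: b_def)
    then have bb: "b < \<beta>"
      using \<open>\<not> \<beta>^2 \<le> 29/200 * v\<close> assms(7) by (metis leI power_mono less_imp_le)
    then have "b^2 \<le> \<beta>^2" using b by (intro power_mono) auto
    then have "d^2 * (3 * b + 2 * b^2) \<le> d^2 * (3 * \<beta> + 2 * \<beta>^2)"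
      using bb by (intro mult_left_mono) auto
    with main bb \<open>b^2 \<le> \<beta>^2\<close> have m2: "2 * b^2 + b + d^2 * (3 * b + 2 * b^2)
      < d^2 * (2 * v + v^2 - d * (6 * v + v^2) / 5)" by linarith
    have v: "v = 200/29 * b^2" using b by simp
    \<comment> \<open>The number 11/25 slightly exceeds the square root of
      \<open>29/200 * 4/3\<close>.\<close>
    have "b^2 \<le> (11/25)^2" using b assms(4) by (simp add: power2_eq_square)
    then have b_le: "b \<le> 11/25" by (rule power2_le_imp_le) simp
    define P where "P = 200/29 * (2 * d^2 - 6/5 * d^3)"
    define Q where "Q = (200/29)^2 * (d^2 - d^3 / 5)"
    have d3: "d^3 \<le> d^2" using d by (intro power_decreasing) auto
    have "0 \<le> d^2 - d^3 / 5" using d3 D by linarith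
    then have Q: "0 \<le> Q" unfolding Q_def by (rule mult_nonneg_nonneg[rotated]) simp
    have "b * (2 * b + 1 + d^2 * (3 + 2 * b)) < b * (P * b + Q * b^3)"
      using m2 unfolding v P_def Q_def
      by (simp add: power2_eq_square power3_eq_cube field_simps)
    then have m3: "2 * b + 1 + d^2 * (3 + 2 * b) < P * b + Q * b^3"
      using b by simp
    \<comment> \<open>This makes the inequality linear in \<open>b\<close>, so it can be tested at
      the largest value 11/25, leaving a cubic in d.\<close>
    have "Q * b^3 \<le> Q * ((11/25)^2 * b)"
    proof (rule mult_left_mono[OF _ Q])
      have "b^2 * b \<le> (11/25)^2 * b" using b \<open>b^2 \<le> (11/25)^2\<close> by (intro mult_right_mono) auto
      then show "b^3 \<le> (11/25)^2 * b" by (simp add: power2_eq_square power3_eq_cube)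
    qed
    with m3 have m4: "1 + 3 * d^2 < b * (P + (11/25)^2 * Q - 2 - 2 * d^2)"
      by (simp add: algebra_simps)
    have "0 \<le> 1 + 3 * d^2" by simp
    with m4 have "0 < b * (P + (11/25)^2 * Q - 2 - 2 * d^2)" by linarith
    then have "0 \<le> P + (11/25)^2 * Q - 2 - 2 * d^2"
      using b by (simp add: zero_less_mult_iff)
    with b_le have "b * (P + (11/25)^2 * Q - 2 - 2 * d^2)
        \<le> 11/25 * (P + (11/25)^2 * Q - 2 - 2 * d^2)" by (intro mult_right_mono) auto
    with m4 have m5: "1 + 3 * d^2 < 11/25 * (P + (11/25)^2 * Q - 2 - 2 * d^2)" by linarith
    \<comment> \<open>Double-root bound for \<open>d^3\<close>, placed near the point where the
      cubic in \<open>m5\<close> comes closest to holding.\<close>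
    have "0 \<le> (d - 93/100)^2 * (d + 93/200)" using d by simp
    then have "0 \<le> d^3 - 279/200 * d^2 + 804357/2000000"
      by (simp add: power2_eq_square power3_eq_cube field_simps)
    then show False using m5 d3 D d unfolding P_def Q_def by (simp add: power_divide field_simps)
  qed
qed

section \<open>The rate q as a root of \<open>z^2 - b1 * z - b2\<close>\<close>

text \<open>\<open>q_rate\<close> is the larger root of \<open>z^2 - b1 * z - b2\<close>, and this
  polynomial is nonpositive only between its roots.\<close>

lemma q_rate_ge:
  assumes "0 \<le> z" "z^2 \<le> b1 \<eta> \<gamma> K \<beta> * z + b2 \<beta>"
  shows "z \<le> q_rate \<eta> \<gamma> K \<beta>"
proof -
  define b where "b = b1 \<eta> \<gamma> K \<beta>"
  have "(2 * z - b)^2 \<le> b^2 + 4 * b2 \<beta>"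
    using assms(2) unfolding b_def by (simp add: power2_eq_square algebra_simps)
  then have "2 * z - b \<le> sqrt (b^2 + 4 * b2 \<beta>)" by (rule real_le_rsqrt)
  then show ?thesis unfolding q_rate_def b_def by simp
qed

text \<open>Since \<open>b2 > 0\<close>, the roots have opposite signs; a positive z with a positive
  value of the polynomial therefore lies beyond the larger root.\<close>

lemma q_rate_less:
  assumes "0 < z" "b1 \<eta> \<gamma> K \<beta> * z + b2 \<beta> < z^2" "0 < \<beta>"
  shows "q_rate \<eta> \<gamma> K \<beta> < z"
proof -
  define b where "b = b1 \<eta> \<gamma> K \<beta>"
  have b2: "0 < b2 \<beta>" unfolding b2_def using assms(3) by (simp add: add_pos_pos)
  then have "z * b < z * z"
    using assms(2) unfolding b_def power2_eq_square by (simp add: mult.commute)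
  then have "b < z" using assms(1) by simp
  then have "0 \<le> 2 * z - b" using assms(1) by simp
  moreover have "b^2 + 4 * b2 \<beta> < (2 * z - b)^2"
    using assms(2) unfolding b_def by (simp add: power2_eq_square algebra_simps)
  ultimately have "sqrt (b^2 + 4 * b2 \<beta>) < 2 * z - b"
    by (metis abs_of_nonneg real_sqrt_abs real_sqrt_less_mono)
  then show ?thesis unfolding q_rate_def b_def by simp
qed

text \<open>\<open>xi\<close> is minus the smaller root, and the product \<open>- b2\<close> of the
  roots is not positive.\<close>

lemma xi_nonneg: "0 < \<beta> \<Longrightarrow> 0 \<le> xi \<eta> \<gamma> K \<beta>"
proof -
  assume "0 < \<beta>"
  then have "0 \<le> b2 \<beta>" unfolding b2_def by simp
  then have "b1 \<eta> \<gamma> K \<beta> \<le> sqrt ((b1 \<eta> \<gamma> K \<beta>)^2 + 4 * b2 \<beta>)"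
    by (intro real_le_rsqrt) simp
  then show ?thesis unfolding xi_def q_rate_def by simp
qed

text \<open>Here \<open>v = 1 / \<gamma> - 1\<close>, so that the ratio \<open>\<beta>\<^sup>2 \<gamma> / (1 - \<gamma>)\<close> of the squared step lengths
  is \<open>\<beta>\<^sup>2 / v\<close>.\<close>
lemma tail_rate_le_q_rate:
  assumes "0 < \<eta>" "\<eta> < 1/2" "0 < v" "v \<le> 4/3" "\<gamma> = 1 / (1 + v)" "1 \<le> K"
    and "0 < \<beta>" "\<beta> < C2 \<eta> \<gamma> K"
  defines "y \<equiv> \<beta>^2 / v"
  shows "y * (1 + y) / (1 - y)^3 \<le> q_rate \<eta> \<gamma> K \<beta>"
proof -
  note bounds = momentum_bounds[OF assms(1-8)]
  have y: "0 < y" "y \<le> 29/200"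
    using bounds(2) assms(3,7) by (auto simp: y_def pos_divide_le_eq mult.commute)
  \<comment> \<open>For \<open>y \<le> 29/200\<close> the factor \<open>(1 + y) / (1 - y)^3\<close>
    is at most 11/6, so \<open>z\<close> can replace the tail rate.\<close>
  define z where "z = 11/6 * y"
  define w where "w = \<beta> / v"
  have z: "0 < z" "z \<le> 319/1200" using y by (auto simp: z_def)
  have "(171/200)^3 \<le> (1 - y)^3" using y by (intro power_mono) auto
  then have "(1 + y) / (1 - y)^3 \<le> (229/200) / (171/200)^3"
    using y by (intro frac_le) auto
  also have "\<dots> \<le> 11/6" by (simp add: power3_eq_cube)
  finally have "y * ((1 + y) / (1 - y)^3) \<le> y * (11/6)"
    using y by (intro mult_left_mono) auto
  then have yz: "y * (1 + y) / (1 - y)^3 \<le> z" by (simp add: z_def)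
  \<comment> \<open>\<open>- X\<close> is a lower bound for \<open>b1\<close>, so the criterion for
    \<open>z \<le> q\<close> reduces to \<open>z * (z + X) \<le> b2\<close>.\<close>
  define X where "X = 2 * v + v^2 - (3 * \<beta> + 2 * \<beta>^2)"
  have d: "0 < d_const \<eta>" using d_const_bounds assms by auto
  have c_le: "c_const \<eta> \<gamma> K - 1 \<le> 2 * v + v^2"
  proof -
    have "0 \<le> d_const \<eta> * (6 * v + v^2) / 5" "0 \<le> (d_const \<eta>)^2"
      using d assms(3) by auto
    with c_const_le[OF assms(1-6)] show ?thesis by linarith
  qed
  have w: "3/4 * \<beta> \<le> w" "w \<le> 5/6"
  proof -
    have "\<beta> * v \<le> \<beta> * (4/3)" using assms by (intro mult_left_mono) auto
    then show "3/4 * \<beta> \<le> w" using assms(3) by (simp add: w_def field_simps)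
    have "v * v \<le> 4/3 * v" using assms by (intro mult_right_mono) auto
    then have "\<beta> \<le> 5/6 * v" using bounds(1) by (simp add: power2_eq_square)
    then show "w \<le> 5/6" using assms(3) by (simp add: w_def pos_divide_le_eq)
  qed
  have zw: "z = 11/6 * w * \<beta>" by (simp add: z_def y_def w_def power2_eq_square)
  have vw: "w * v = \<beta>" using assms(3) by (simp add: w_def)
  have "w * \<beta> \<le> 5/6 * \<beta>" using w assms(7) by (intro mult_right_mono) auto
  moreover have "z = 11/6 * (w * \<beta>)" by (simp add: zw)
  ultimately have zk: "z \<le> 3 * \<beta> + 2 * \<beta>^2" using assms(7) zero_le_power2[of \<beta>] by linarith
  have "3/4 * \<beta> * (3 * \<beta> + 2 * \<beta>^2 - z) \<le> w * (3 * \<beta> + 2 * \<beta>^2 - z)"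
    using w zk by (intro mult_right_mono) auto
  moreover have "3/4 * \<beta> * (3 * \<beta> + 2 * \<beta>^2 - 319/1200) \<le> 3/4 * \<beta> * (3 * \<beta> + 2 * \<beta>^2 - z)"
    using z assms(7) by (intro mult_left_mono) auto
  ultimately have k: "3/4 * \<beta> * (3 * \<beta> + 2 * \<beta>^2 - 319/1200) \<le> w * (3 * \<beta> + 2 * \<beta>^2 - z)"
    by linarith
  \<comment> \<open>By \<open>w * v = \<beta>\<close> this is linear in v;
    \<open>v \<le> 4/3\<close> and \<open>k\<close> then leave a polynomial in \<beta>
    alone.\<close>
  have "w * (z + X) = \<beta> * (2 + v) - w * (3 * \<beta> + 2 * \<beta>^2 - z)"
    unfolding X_def vw[symmetric] by (simp add: algebra_simps power2_eq_square)
  also have "\<dots> \<le> \<beta> * (10/3) - 3/4 * \<beta> * (3 * \<beta> + 2 * \<beta>^2 - 319/1200)"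
    using k assms(4,7) by (intro diff_mono mult_left_mono) auto
  finally have "11/6 * (w * (z + X))
      \<le> 11/6 * (\<beta> * (10/3) - 3/4 * \<beta> * (3 * \<beta> + 2 * \<beta>^2 - 319/1200))" by simp
  also have "\<dots> \<le> 1 + 2 * \<beta>"
  proof -
    define T where "T = 11/6 * (\<beta> * (10/3) - 3/4 * \<beta> * (3 * \<beta> + 2 * \<beta>^2 - 319/1200))"
    \<comment> \<open>Double-root form at 39/100, close to the minimum of the cubic on the positive
      axis; the remaining terms are visibly nonnegative.\<close>
    have "28800 * (1 + 2 * \<beta> - T)
        = 79200 * ((\<beta> - 39/100)^2 * (\<beta> + 78/100)) + 118800 * (\<beta> - 1953/5000)^2
          + 1278749232/1000000 + 1852/100 * \<beta>"
      unfolding T_def by (simp add: power2_eq_square power3_eq_cube field_simps)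
    also have "\<dots> \<ge> 0" using assms(7) by (intro add_nonneg_nonneg mult_nonneg_nonneg) auto
    finally have "T \<le> 1 + 2 * \<beta>" by simp
    then show ?thesis unfolding T_def .
  qed
  finally have "\<beta> * (11/6 * (w * (z + X))) \<le> \<beta> * (1 + 2 * \<beta>)"
    using assms(7) by (intro mult_left_mono) auto
  then have main: "z * (z + X) \<le> b2 \<beta>"
    by (simp add: zw b2_def power2_eq_square algebra_simps)
  have "- X \<le> b1 \<eta> \<gamma> K \<beta>"
    using c_le unfolding X_def b1_def c_const_def by simp
  then have "z * (- X) \<le> z * b1 \<eta> \<gamma> K \<beta>" using z by (intro mult_left_mono) auto
  with main have "z^2 \<le> b1 \<eta> \<gamma> K \<beta> * z + b2 \<beta>"
    by (simp add: power2_eq_square algebra_simps)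
  with z have "z \<le> q_rate \<eta> \<gamma> K \<beta>" by (intro q_rate_ge) auto
  with yz show ?thesis by linarith
qed

lemma q_rate_less_d:
  assumes "0 < \<eta>" "\<eta> < 1/2" "0 < \<beta>" "\<beta> < C2 \<eta> \<gamma> K"
  shows "q_rate \<eta> \<gamma> K \<beta> < (d_const \<eta>)^2" and "(d_const \<eta>)^2 < 1"
proof -
  note d = d_const_bounds[OF assms(1,2)]
  show "(d_const \<eta>)^2 < 1" using d by (simp add: power_less_one_iff)
  show "q_rate \<eta> \<gamma> K \<beta> < (d_const \<eta>)^2"
    using less_C2D[OF assms(3,4)] d assms(3)
    by (intro q_rate_less) (auto simp: b1_def b2_def c_const_def power2_eq_square algebra_simps)
qed

section \<open>Sequences with orthogonal, geometrically shrinking steps\<close>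

lemma orthogonal_steps_partial:
  fixes x :: "nat \<Rightarrow> 'a::real_inner"
  assumes orth: "\<And>k. (x (Suc (Suc k)) - x (Suc k)) \<bullet> (x (Suc k) - x k) = 0"
    and contr: "\<And>k. (norm (x (Suc (Suc k)) - x (Suc k)))^2 \<le> y * (norm (x (Suc k) - x k))^2"
    and y: "0 \<le> y" "y < 1"
  shows "norm (x (k + n) - x k) \<le> sqrt (1 + y) / (1 - y) * norm (x (Suc k) - x k)"
\<comment> \<open>pairing consecutive (orthogonal) steps beats the plain geometric bound \<open>1 / (1 - sqrt y)\<close>\<close>
proof (induction n arbitrary: k rule: induct_nat_012)
  case 0
  then show ?case using y by simp
next
  case 1
  have "1 \<le> sqrt (1 + y) / (1 - y)"
  proof -
    have "1 - y \<le> 1" "1 \<le> sqrt (1 + y)" using y by auto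
    then have "1 - y \<le> sqrt (1 + y)" by linarith
    then show ?thesis using y by (simp add: pos_le_divide_eq)
  qed
  from mult_right_mono[OF this norm_ge_zero[of "x (Suc k) - x k"]] show ?case by simp
next
  case (ge2 n)
  define N where "N j = norm (x (Suc j) - x j)" for j
  have N2: "N (Suc j) \<le> sqrt y * N j" for j
  proof -
    have "sqrt ((N (Suc j))^2) \<le> sqrt (y * (N j)^2)"
      unfolding N_def by (intro real_sqrt_le_mono contr)
    then show ?thesis using y by (simp add: real_sqrt_mult N_def)
  qed
  have "N (Suc (Suc k)) \<le> sqrt y * (sqrt y * N k)"
    using N2[of "Suc k"] N2[of k] y
    by (meson mult_left_mono order_trans real_sqrt_ge_zero)
  then have N3: "N (Suc (Suc k)) \<le> y * N k" using y by (simp flip: mult.assoc)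
  have "(norm ((x (Suc (Suc k)) - x (Suc k)) + (x (Suc k) - x k)))^2 = (N (Suc k))^2 + (N k)^2"
    unfolding N_def by (intro norm_add_Pythagorean) (simp add: orthogonal_def orth)
  also have "\<dots> \<le> (1 + y) * (N k)^2"
    using contr[of k] by (simp add: N_def algebra_simps)
  finally have "norm (x (Suc (Suc k)) - x k) \<le> sqrt ((1 + y) * (N k)^2)"
    by (intro real_le_rsqrt) simp
  then have two: "norm (x (Suc (Suc k)) - x k) \<le> sqrt (1 + y) * N k"
    using y by (simp add: real_sqrt_mult N_def)
  have "norm (x (k + Suc (Suc n)) - x k)
      \<le> norm (x (Suc (Suc k) + n) - x (Suc (Suc k))) + norm (x (Suc (Suc k)) - x k)"
    by (metis add_Suc_right add_Suc norm_diff_triangle_le order_refl)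
  also have "\<dots> \<le> sqrt (1 + y) / (1 - y) * (y * N k) + sqrt (1 + y) * N k"
  proof (rule add_mono[OF _ two])
    have "norm (x (Suc (Suc k) + n) - x (Suc (Suc k))) \<le> sqrt (1 + y) / (1 - y) * N (Suc (Suc k))"
      using ge2(1)[of "Suc (Suc k)"] by (simp add: N_def)
    also have "\<dots> \<le> sqrt (1 + y) / (1 - y) * (y * N k)"
      using N3 y by (intro mult_left_mono) auto
    finally show "norm (x (Suc (Suc k) + n) - x (Suc (Suc k))) \<le> \<dots>" .
  qed
  \<comment> \<open>The constant is the fixed point of \<open>B = y * B + sqrt (1 + y)\<close>,
    which closes the induction.\<close>
  also have "\<dots> = sqrt (1 + y) / (1 - y) * N k"
    using y by (simp add: field_simps)
  finally show ?case by (simp add: N_def)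
qed

text \<open>The distance to the limit is at most \<open>B\<close> times the next step. Expanding
  \<open>x k - a\<close> along \<open>u k\<close> gives a bound from the other side, with a small
  cross term because \<open>u (Suc k)\<close> is orthogonal to \<open>u k\<close>. Eliminating the
  step length from the two bounds leaves the contraction.\<close>

lemma orthogonal_steps_tail:
  fixes x :: "nat \<Rightarrow> 'a::real_inner"
  assumes orth: "\<And>k. (x (Suc (Suc k)) - x (Suc k)) \<bullet> (x (Suc k) - x k) = 0"
    and contr: "\<And>k. (norm (x (Suc (Suc k)) - x (Suc k)))^2 \<le> y * (norm (x (Suc k) - x k))^2"
    and y: "0 < y" "y \<le> 29/200"
    and lim: "x \<longlonglongrightarrow> a"
  shows "(norm (x (Suc k) - a))^2 \<le> y * (1 + y) / (1 - y)^3 * (norm (x k - a))^2"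
proof -
  define B where "B = sqrt (1 + y) / (1 - y)"
  define u where "u j = x (Suc j) - x j" for j
  have B2: "B^2 = (1 + y) / (1 - y)^2" using y by (simp add: B_def power_divide)
  have B: "0 < B" using y by (simp add: B_def)
  have tail: "norm (x j - a) \<le> B * norm (u j)" for j
  proof -
    have "(\<lambda>n. norm (x (j + n) - x j)) \<longlonglongrightarrow> norm (a - x j)"
      using LIMSEQ_ignore_initial_segment[OF lim, of j]
      by (intro tendsto_intros) (simp add: add.commute)
    then have "norm (a - x j) \<le> B * norm (u j)"
      by (rule tendsto_upperbound)
        (use orthogonal_steps_partial[of x y, OF orth contr] y in \<open>auto simp: B_def u_def\<close>)
    then show ?thesis by (simp add: norm_minus_commute)
  qed
  have uu: "(norm (u (Suc j)))^2 \<le> y * (norm (u j))^2" for j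
    using contr by (simp add: u_def)
  have E1: "(norm (x (Suc k) - a))^2 \<le> B^2 * (y * (norm (u k))^2)"
  proof -
    have "(norm (x (Suc k) - a))^2 \<le> (B * norm (u (Suc k)))^2"
      by (intro power_mono tail) simp
    also have "\<dots> \<le> B^2 * (y * (norm (u k))^2)"
      unfolding power_mult_distrib by (intro mult_left_mono uu) simp
    finally show ?thesis .
  qed
  have "norm (u (Suc (Suc k))) \<le> y * norm (u k)"
  proof (rule power2_le_imp_le)
    have "(norm (u (Suc (Suc k))))^2 \<le> y * (y * (norm (u k))^2)"
      using uu[of "Suc k"] uu[of k] y by (meson mult_left_mono order_trans less_imp_le)
    then show "(norm (u (Suc (Suc k))))^2 \<le> (y * norm (u k))^2"
      by (simp add: power2_eq_square mult_ac)
  qed (use y in auto)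
  then have "norm (x (Suc (Suc k)) - a) \<le> B * (y * norm (u k))"
    using tail[of "Suc (Suc k)"] B by (meson mult_left_mono order_trans less_imp_le)
  then have "norm (x (Suc (Suc k)) - a) * norm (u k) \<le> B * (y * norm (u k)) * norm (u k)"
    by (rule mult_right_mono) simp
  \<comment> \<open>Orthogonality moves the cross term one iterate further, where the error is
    already smaller by a factor y relative to \<open>B * norm (u k)\<close>.\<close>
  moreover have "(x (Suc k) - a) \<bullet> u k = (x (Suc (Suc k)) - a) \<bullet> u k"
    using orth[of k] by (simp add: u_def inner_diff_left algebra_simps)
  ultimately have ip: "(x (Suc k) - a) \<bullet> u k \<le> y * B * (norm (u k))^2"
    using norm_cauchy_schwarz[of "x (Suc (Suc k)) - a" "u k"]
    by (simp add: power2_eq_square algebra_simps)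
  have "x k - a = (x (Suc k) - a) - u k" by (simp add: u_def)
  then have "(norm (x k - a))^2 = (norm (x (Suc k) - a))^2 + (norm (u k))^2 - 2 * ((x (Suc k) - a) \<bullet> u k)"
    by (simp only: power2_norm_eq_inner) (simp add: inner_diff_left inner_diff_right inner_commute)
  with ip have E0: "(norm (x (Suc k) - a))^2 + (1 - 2 * y * B) * (norm (u k))^2 \<le> (norm (x k - a))^2"
    by (simp add: algebra_simps)
  have "B \<le> 2"
  proof (rule power2_le_imp_le)
    have "171/200 * (171/200) \<le> (1 - y) * (1 - y)" using y by (intro mult_mono) auto
    then have "(1 + y) \<le> 4 * (1 - y)^2" using y by (simp add: power2_eq_square)
    then show "B^2 \<le> 2^2" using y by (simp add: B2 pos_divide_le_eq)
  qed simp
  then have "y * B \<le> 29/200 * 2" using y B by (intro mult_mono) auto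
  then have t: "0 \<le> 1 - 2 * y * B" by simp
  define \<psi> where "\<psi> = B^2 * y / (1 - y)"
  have psi: "\<psi> = y * (1 + y) / (1 - y)^3"
    unfolding \<psi>_def B2 by (simp add: power2_eq_square power3_eq_cube mult_ac)
  \<comment> \<open>Adding \<open>y * (B - 1)^2\<close> completes the coefficient to
    \<open>B^2 * y + (1 - 2 * y * B)\<close>, the weights with which \<open>E0\<close> and
    \<open>E1\<close> combine.\<close>
  have "(1 - y) * (norm (x (Suc k) - a))^2
      \<le> (1 - y + y * (B - 1)^2) * (norm (x (Suc k) - a))^2"
    using y by (intro mult_right_mono) auto
  also have "\<dots> = B^2 * y * (norm (x (Suc k) - a))^2 + (1 - 2 * y * B) * (norm (x (Suc k) - a))^2"
    by (simp add: power2_eq_square algebra_simps)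
  also have "\<dots> \<le> B^2 * y * (norm (x (Suc k) - a))^2 + (1 - 2 * y * B) * (B^2 * (y * (norm (u k))^2))"
    using E1 t by (intro add_left_mono mult_left_mono) auto
  also have "\<dots> = B^2 * y * ((norm (x (Suc k) - a))^2 + (1 - 2 * y * B) * (norm (u k))^2)"
    by (simp add: algebra_simps)
  also have "\<dots> \<le> B^2 * y * (norm (x k - a))^2"
    using E0 y by (intro mult_left_mono) auto
  finally have "(norm (x (Suc k) - a))^2 \<le> \<psi> * (norm (x k - a))^2"
    using y unfolding \<psi>_def by (simp add: field_simps)
  then show ?thesis by (simp add: psi)
qed

text \<open>All iterates after index \<open>M\<close> stay within a fixed multiple of the step at
  \<open>M\<close>, and the steps vanish geometrically.\<close>

lemma orthogonal_steps_Cauchy: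
  fixes x :: "nat \<Rightarrow> 'a::real_inner"
  assumes orth: "\<And>k. (x (Suc (Suc k)) - x (Suc k)) \<bullet> (x (Suc k) - x k) = 0"
    and contr: "\<And>k. (norm (x (Suc (Suc k)) - x (Suc k)))^2 \<le> y * (norm (x (Suc k) - x k))^2"
    and y: "0 \<le> y" "y < 1"
  shows "(\<lambda>k. x (Suc k) - x k) \<longlonglongrightarrow> 0" and "Cauchy x"
proof -
  have pow: "(norm (x (Suc k) - x k))^2 \<le> y^k * (norm (x (Suc 0) - x 0))^2" for k
  proof (induction k)
    case (Suc k)
    have "(norm (x (Suc (Suc k)) - x (Suc k)))^2 \<le> y * (norm (x (Suc k) - x k))^2" by (rule contr)
    also have "\<dots> \<le> y * (y^k * (norm (x (Suc 0) - x 0))^2)" using Suc y by (intro mult_left_mono)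
    finally show ?case by (simp add: mult_ac)
  qed simp
  have "(\<lambda>k. y^k * (norm (x (Suc 0) - x 0))^2) \<longlonglongrightarrow> 0"
    using y by (intro tendsto_mult_left_zero LIMSEQ_power_zero) simp
  then have "(\<lambda>k. (norm (x (Suc k) - x k))^2) \<longlonglongrightarrow> 0"
    by (rule Lim_null_comparison[rotated]) (simp add: pow)
  then have "(\<lambda>k. norm (x (Suc k) - x k)) \<longlonglongrightarrow> 0"
    using tendsto_real_sqrt by fastforce
  then show u0: "(\<lambda>k. x (Suc k) - x k) \<longlonglongrightarrow> 0" by (rule tendsto_norm_zero_cancel)
  define B where "B = sqrt (1 + y) / (1 - y)"
  have "(\<lambda>k. B * norm (x (Suc k) - x k)) \<longlonglongrightarrow> B * 0"
    using u0 by (intro tendsto_mult tendsto_const tendsto_norm_zero)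
  show "Cauchy x"
  proof (rule metric_CauchyI)
    fix e :: real assume "0 < e"
    then have "\<forall>\<^sub>F k in sequentially. B * norm (x (Suc k) - x k) < e / 2"
      using \<open>(\<lambda>k. B * norm (x (Suc k) - x k)) \<longlonglongrightarrow> B * 0\<close> by (intro order_tendstoD(2)) auto
    from eventually_happens'[OF sequentially_bot this]
    obtain M where M: "B * norm (x (Suc M) - x M) < e / 2" by blast
    have "dist (x m) (x M) < e / 2" if "M \<le> m" for m
    proof -
      have "dist (x (M + (m - M))) (x M) \<le> B * norm (x (Suc M) - x M)"
        unfolding dist_norm B_def using orth contr y by (rule orthogonal_steps_partial)
      with M that show ?thesis by simp
    qed
    then have "dist (x m) (x n) < e" if "M \<le> m" "M \<le> n" for m n
      using that by (metis dist_triangle_half_l)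
    then show "\<exists>M. \<forall>m\<ge>M. \<forall>n\<ge>M. dist (x m) (x n) < e" by blast
  qed
qed

section \<open>Block residuals, block gradients and the momentum step\<close>

lemma block_grad_inner:
  "block_grad \<theta> F F' y \<bullet> v = (\<Sum>i\<in>block_set \<theta> F y. F y $ i * (F' y $ i \<bullet> v))"
proof -
  have "block_grad \<theta> F F' y \<bullet> v = block_F \<theta> F y \<bullet> (block_jac \<theta> F F' y *v v)"
    by (simp add: block_grad_def transpose_matrix_vector dot_lmul_matrix)
  also have "\<dots> = (\<Sum>i\<in>UNIV. if i \<in> block_set \<theta> F y then F y $ i * (F' y $ i \<bullet> v) else 0)"
    unfolding inner_vec_def matrix_vector_mul_component
    by (intro sum.cong) (auto simp: block_F_def subvector_def block_jac_def row_submatrix_def inner_vec_def)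
  finally show ?thesis by (simp add: sum.If_cases)
qed

lemma norm_block_F: "(norm (block_F \<theta> F y))\<^sup>2 = (\<Sum>i\<in>block_set \<theta> F y. (F y $ i)\<^sup>2)"
proof -
  have "(norm (block_F \<theta> F y))\<^sup>2
      = (\<Sum>i\<in>UNIV. if i \<in> block_set \<theta> F y then (F y $ i)\<^sup>2 else 0)"
    unfolding power2_norm_eq_inner inner_vec_def
    by (intro sum.cong) (auto simp: block_F_def subvector_def power2_eq_square)
  then show ?thesis by (simp add: sum.If_cases)
qed

text \<open>For \<open>\<theta> \<le> 1\<close> the block contains an index of maximal residual.
  Hence vanishing block residuals force all of F to vanish in the limit.\<close>

lemma component_le_norm_block_F:
  assumes "\<theta> \<le> 1"
  shows "(F y $ j)\<^sup>2 \<le> (norm (block_F \<theta> F y))\<^sup>2"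
proof -
  define S where "S = range (\<lambda>j. \<bar>F y $ j\<bar>\<^sup>2)"
  have "Max S \<in> S" unfolding S_def by (intro Max_in) auto
  then obtain i where i: "Max S = \<bar>F y $ i\<bar>\<^sup>2" unfolding S_def by (rule rangeE)
  have "\<theta> * Max S \<le> 1 * Max S" using assms unfolding i by (intro mult_right_mono) auto
  then have "i \<in> block_set \<theta> F y" unfolding block_set_def S_def[symmetric] using i by simp
  have "\<bar>F y $ j\<bar>\<^sup>2 \<le> Max S" unfolding S_def by (intro Max_ge) auto
  then have "(F y $ j)\<^sup>2 \<le> (F y $ i)\<^sup>2" unfolding i by simp
  also have "\<dots> \<le> (\<Sum>i\<in>block_set \<theta> F y. (F y $ i)\<^sup>2)"
    using \<open>i \<in> block_set \<theta> F y\<close> by (intro member_le_sum) auto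
  finally show ?thesis by (simp add: norm_block_F)
qed

text \<open>Allows the factor \<open>block_jac_norm2\<close> in \<open>mom_alpha\<close> to cancel
  against the division by it in the update.\<close>

lemma block_jac_norm2_nonzero:
  assumes "block_grad \<theta> F F' y \<noteq> 0"
  shows "block_jac_norm2 \<theta> F F' y \<noteq> 0"
proof
  assume "block_jac_norm2 \<theta> F F' y = 0"
  then have "\<forall>i\<in>block_set \<theta> F y. F' y $ i = 0"
    unfolding block_jac_norm2_def by (subst (asm) sum_nonneg_eq_0_iff) auto
  then have "block_grad \<theta> F F' y \<bullet> block_grad \<theta> F F' y = 0"
    by (subst block_grad_inner) simp
  with assms show False by simp
qed

text \<open>The coefficients solve the linear system \<open>u \<bullet> g = - f\<close>,
  \<open>u \<bullet> s = 0\<close> in the span of g and s, with Gram determinant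
  \<open>mom_Delta\<close>. It follows that \<open>norm u\<close> is \<open>mom_beta\<close> times
  the tangent of the angle times \<open>norm s\<close>, and the sine bound turns into a tangent
  bound.\<close>

lemma momentum_step:
  fixes F :: "real ^ 'n \<Rightarrow> real ^ 'm" and F' :: "real ^ 'n \<Rightarrow> real ^ 'n ^ 'm"
  assumes Delta: "mom_Delta \<theta> F F' y z \<noteq> 0"
  defines "g \<equiv> block_grad \<theta> F F' y" and "s \<equiv> y - z" and "f \<equiv> (norm (block_F \<theta> F y))\<^sup>2"
  defines "u \<equiv> mom_beta \<theta> F F' y z *\<^sub>R s
      - mom_alpha \<theta> F F' y z *\<^sub>R ((1 / block_jac_norm2 \<theta> F F' y) *\<^sub>R g)"
  shows "u \<bullet> g = - f" and "u \<bullet> s = 0"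
    and "0 < mom_beta \<theta> F F' y z \<Longrightarrow> mom_beta \<theta> F F' y z \<le> \<beta>
      \<Longrightarrow> (sin (mom_angle \<theta> F F' y z))\<^sup>2 \<le> \<gamma> \<Longrightarrow> 0 < \<gamma> \<Longrightarrow> \<gamma> < 1
      \<Longrightarrow> (norm u)\<^sup>2 \<le> \<beta>\<^sup>2 * \<gamma> / (1 - \<gamma>) * (norm s)\<^sup>2"
proof -
  define D where "D = (norm g)\<^sup>2 * (norm s)\<^sup>2 - (g \<bullet> s)\<^sup>2"
  have D_eq: "mom_Delta \<theta> F F' y z = D" by (simp add: mom_Delta_def D_def g_def s_def)
  have "(g \<bullet> s)\<^sup>2 \<le> (norm g)\<^sup>2 * (norm s)\<^sup>2"
    using Cauchy_Schwarz_ineq[of g s] by (simp add: power2_norm_eq_inner)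
  then have D: "0 < D" using Delta unfolding D_eq D_def by simp
  then have gs: "g \<noteq> 0" "s \<noteq> 0" unfolding D_def by auto
  define a b where "a = (norm s)\<^sup>2 * f / D" and "b = (s \<bullet> g) * f / D"
  have b_eq: "mom_beta \<theta> F F' y z = b"
    by (simp add: mom_beta_def D_eq b_def g_def s_def f_def)
  have "mom_alpha \<theta> F F' y z * (1 / block_jac_norm2 \<theta> F F' y) = a"
    using block_jac_norm2_nonzero[of \<theta> F F' y] gs(1)
    by (simp add: mom_alpha_def D_eq a_def g_def s_def f_def)
  then have u: "u = b *\<^sub>R s - a *\<^sub>R g"
    unfolding u_def b_eq by simp
  have "(b * (s \<bullet> g) - a * (norm g)\<^sup>2) * D = - f * D"
    using D unfolding a_def b_def by (simp add: field_simps) (simp add: D_def inner_commute power2_eq_square algebra_simps)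
  then have "b * (s \<bullet> g) - a * (norm g)\<^sup>2 = - f"
    using D by (simp only: mult_right_cancel[OF less_imp_neq[OF D, symmetric]])
  then show ug: "u \<bullet> g = - f"
    unfolding u by (simp add: inner_diff_left power2_norm_eq_inner)
  show us: "u \<bullet> s = 0"
    unfolding u a_def b_def by (simp add: inner_diff_left inner_diff_right power2_norm_eq_inner inner_commute)
  assume beta: "0 < mom_beta \<theta> F F' y z" "mom_beta \<theta> F F' y z \<le> \<beta>"
    and angle: "(sin (mom_angle \<theta> F F' y z))\<^sup>2 \<le> \<gamma>" and \<gamma>: "0 < \<gamma>" "\<gamma> < 1"
  have "u \<bullet> u = b * (u \<bullet> s) - a * (u \<bullet> g)"
    by (subst (2) u) (simp add: inner_diff_right)
  then have uu: "(norm u)\<^sup>2 = a * f" using ug us by (simp add: power2_norm_eq_inner)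
  define t where "t = (g \<bullet> s) / (norm g * norm s)"
  have "\<bar>t\<bar> \<le> 1"
    using Cauchy_Schwarz_ineq2[of g s] gs by (simp add: t_def abs_mult)
  then have "(sin (mom_angle \<theta> F F' y z))\<^sup>2 = 1 - t\<^sup>2"
    unfolding mom_angle_def g_def[symmetric] s_def[symmetric] t_def[symmetric]
    by (simp add: abs_le_iff sin_squared_eq)
  also have "\<dots> = D / ((norm g)\<^sup>2 * (norm s)\<^sup>2)"
    using gs by (simp add: t_def D_def power_divide power_mult_distrib field_simps)
  finally have "D \<le> \<gamma> * ((norm g)\<^sup>2 * (norm s)\<^sup>2)"
    using angle gs by (simp add: pos_divide_le_eq)
  \<comment> \<open>The bound \<open>\<gamma> / (1 - \<gamma>)\<close> on the squared tangent,
    without a division by \<open>g \<bullet> s\<close>.\<close>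
  then have "(1 - \<gamma>) * D \<le> \<gamma> * (g \<bullet> s)\<^sup>2"
    unfolding D_def by (simp add: algebra_simps)
  then have "(norm s)\<^sup>2 * f\<^sup>2 / D\<^sup>2 * ((1 - \<gamma>) * D) \<le> (norm s)\<^sup>2 * f\<^sup>2 / D\<^sup>2 * (\<gamma> * (g \<bullet> s)\<^sup>2)"
    by (intro mult_left_mono) auto
  also have "\<dots> = \<gamma> * b\<^sup>2 * (norm s)\<^sup>2"
    by (simp add: b_def power_divide power_mult_distrib inner_commute)
  also have "\<dots> \<le> \<gamma> * \<beta>\<^sup>2 * (norm s)\<^sup>2"
    using beta \<gamma> unfolding b_eq by (intro mult_left_mono mult_right_mono power_mono) auto
  also have "(norm s)\<^sup>2 * f\<^sup>2 / D\<^sup>2 * ((1 - \<gamma>) * D) = (1 - \<gamma>) * (norm u)\<^sup>2"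
    using D unfolding uu a_def by (simp add: power2_eq_square)
  finally show "(norm u)\<^sup>2 \<le> \<beta>\<^sup>2 * \<gamma> / (1 - \<gamma>) * (norm s)\<^sup>2"
    using \<gamma> by (simp add: field_simps)
qed

section \<open>Orthogonality of the initial error to the null space\<close>

text \<open>By the cone condition at \<open>xs\<close>, moving a short way along a null vector stays
  in the zero set. So \<open>xs\<close> is the point of such a segment closest to \<open>x0\<close>,
  which gives one sign of the inner product; the opposite vector gives the other.\<close>

lemma min_norm_solution_orthogonal:
  fixes F :: "real ^ 'n \<Rightarrow> real ^ 'm" and F' :: "real ^ 'n \<Rightarrow> real ^ 'n ^ 'm"
  assumes "0 < r" and D: "cball x0 r \<subseteq> D"
    and cone: "\<And>i z. z \<in> cball x0 r \<Longrightarrow>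
          \<bar>F xs $ i - F z $ i - F' xs $ i \<bullet> (xs - z)\<bar> \<le> \<eta> * \<bar>F xs $ i - F z $ i\<bar>"
    and "\<eta> < 1"
    and mns: "min_norm_solution D F x0 r xs"
    and inner: "xs \<in> cball x0 (r/4)"
    and v: "v \<in> null_space (F' xs)"
  shows "v \<bullet> (x0 - xs) = 0"
proof -
  have F0: "F xs = 0" and min: "\<And>y. y \<in> zero_set D F \<Longrightarrow> y \<in> cball x0 r \<Longrightarrow> norm (xs - x0) \<le> norm (y - x0)"
    using mns by (auto simp: min_norm_solution_def zero_set_def)
  have small: "v \<bullet> (x0 - xs) \<le> 0" if v: "v \<in> null_space (F' xs)" and nv: "norm v \<le> r/4" for v
  proof -
    have "dist x0 xs \<le> dist x0 z" if z: "z \<in> closed_segment xs (xs + v)" for z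
    proof -
      obtain t where t: "0 \<le> t" "t \<le> 1" "z = xs + t *\<^sub>R v"
        using z by (auto simp: closed_segment_def algebra_simps)
      have "norm (t *\<^sub>R v) \<le> 1 * norm v"
        unfolding norm_scaleR using t by (intro mult_right_mono) auto
      then have "dist xs z \<le> r/4" using nv t(3) by (simp add: dist_norm)
      then have zb: "z \<in> cball x0 r"
        using inner dist_triangle[of x0 z xs] \<open>0 < r\<close> by (simp add: mem_cball)
      have "F z $ i = 0" for i
      proof -
        have "F' xs $ i \<bullet> v = 0"
          using v by (metis (mono_tags) matrix_vector_mul_component mem_Collect_eq null_space_def zero_index)
        then have "\<bar>F z $ i\<bar> \<le> \<eta> * \<bar>F z $ i\<bar>"
          using cone[OF zb, of i] by (simp add: F0 t(3))
        then have "(1 - \<eta>) * \<bar>F z $ i\<bar> \<le> 0" by (simp add: algebra_simps)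
        then show ?thesis using \<open>\<eta> < 1\<close> by (simp add: mult_le_0_iff)
      qed
      then have "F z = 0" by (simp add: vec_eq_iff)
      then have "norm (xs - x0) \<le> norm (z - x0)"
        using zb D by (intro min) (auto simp: zero_set_def)
      then show ?thesis by (simp add: dist_norm norm_minus_commute)
    qed
    then have "(x0 - xs) \<bullet> ((xs + v) - xs) \<le> 0"
      by (intro any_closest_point_dot[of "closed_segment xs (xs + v)"]) auto
    then show ?thesis by (simp add: inner_commute)
  qed
  \<comment> \<open>Scaling to length at most \<open>r/4\<close> makes \<open>small\<close>
    applicable; the added 1 covers \<open>v = 0\<close>.\<close>
  define t where "t = (r/4) / (norm v + 1)"
  have t: "0 < t" using \<open>0 < r\<close> by (simp add: t_def add_nonneg_pos)
  have "t * norm v \<le> t * (norm v + 1)" using t by (intro mult_left_mono) auto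
  also have "t * (norm v + 1) = r/4"
    unfolding t_def by (rule nonzero_eq_divide_eq[THEN iffD1]) (use norm_ge_zero[of v] in linarith, simp)
  finally have "norm (t *\<^sub>R v) \<le> r/4" using t by simp
  moreover have "t *\<^sub>R v \<in> null_space (F' xs)" "- (t *\<^sub>R v) \<in> null_space (F' xs)"
    using v matrix_vector_mult_scaleR[of "F' xs" t v] matrix_vector_mult_scaleR[of "F' xs" "- t" v]
    by (auto simp: null_space_def)
  ultimately have "t * (v \<bullet> (x0 - xs)) = 0"
    using small[of "t *\<^sub>R v"] small[of "- (t *\<^sub>R v)"] by simp
  then show ?thesis using t by simp
qed

theorem theorem3p10:
  fixes D :: "(real ^ 'n) set"
    and F :: "real ^ 'n \<Rightarrow> real ^ 'm"
    and F' :: "real ^ 'n \<Rightarrow> real ^ 'n ^ 'm"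
    and x0 xs :: "real ^ 'n"
    and x :: "nat \<Rightarrow> real ^ 'n"
    and \<eta>c :: "'m \<Rightarrow> real"
    and \<delta>0 \<eta> \<theta> \<gamma> K \<beta>max :: real
  assumes "bounded D" and "closed_domain D" and "x0 \<in> D"
    and differentiable: "\<And>i y. y \<in> D \<Longrightarrow>
          ((\<lambda>u. F u $ i) has_derivative (\<lambda>h. F' y $ i \<bullet> h)) (at y within D)"
    and "\<delta>0 > 0" and "cball x0 \<delta>0 \<subseteq> D"
    and "\<And>i. \<eta>c i \<ge> 0"
    and cone: "\<And>i y z. y \<in> cball x0 \<delta>0 \<Longrightarrow> z \<in> cball x0 \<delta>0 \<Longrightarrow>
          \<bar>F y $ i - F z $ i - F' y $ i \<bullet> (y - z)\<bar> \<le> \<eta>c i * \<bar>F y $ i - F z $ i\<bar>"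
    and "\<eta> = (MAX i. \<eta>c i)" and "0 < \<eta>" and "\<eta> < 1/2"
    and "cball x0 (\<delta>0/4) \<inter> zero_set D F \<noteq> {}"
    and "\<exists>y \<in> cball x0 \<delta>0. \<forall>i. transpose (F' y) *v axis i 1 \<noteq> 0"
    and "min_norm_solution D F x0 \<delta>0 xs"
    and "\<And>y. y \<in> cball xs (\<delta>0/2) \<Longrightarrow> null_space (F' xs) \<subseteq> null_space (F' y)"
    and "0 < \<theta>" and "\<theta> \<le> 1"
    and "algorithm_A \<theta> F F' x0 x"
    and "\<And>k. k \<ge> 1 \<Longrightarrow> mom_Delta \<theta> F F' (x k) (x (k - 1)) \<noteq> 0"
    and "\<gamma> \<in> {eps0 \<eta> / 2 <..< eps0 \<eta>}"
    and "K \<in> {1 ..< C1 \<eta> \<gamma>}"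
    and cond1: "\<And>k. kappa (block_jac \<theta> F F' (x k)) \<le> K"
    and "\<beta>max \<in> {0 <..< C2 \<eta> \<gamma> K}"
    and cond2: "\<And>k. k \<ge> 1 \<Longrightarrow> mom_beta \<theta> F F' (x k) (x (k - 1)) \<in> {0 <..< \<beta>max}"
    and cond3: "\<And>k. k \<ge> 1 \<Longrightarrow> (sin (mom_angle \<theta> F F' (x k) (x (k - 1))))\<^sup>2 \<le> \<gamma>"
  shows "(\<forall>k. x k \<in> cball xs (\<delta>0/2)) \<and> cball xs (\<delta>0/2) \<subseteq> cball x0 \<delta>0 \<and>
    (\<forall>k. F (x k) \<noteq> 0 \<longrightarrow>
       x (k + 1) - xs \<in> orthogonal_comp (null_space (F' xs)) \<and>
       (norm (x (k + 1) - xs))\<^sup>2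
         \<le> (q_rate \<eta> \<gamma> K \<beta>max)^k * (1 + xi \<eta> \<gamma> K \<beta>max) * (norm (x0 - xs))\<^sup>2) \<and>
    q_rate \<eta> \<gamma> K \<beta>max < (d_const \<eta>)\<^sup>2 \<and> (d_const \<eta>)\<^sup>2 < 1"
proof -

  \<comment> \<open>The recursion and the ratio y\<close>
  have x_0: "x 0 = x0" and x_1: "x (Suc 0) = x0 - ((norm (block_F \<theta> F x0))\<^sup>2
      / (norm (block_grad \<theta> F F' x0))\<^sup>2) *\<^sub>R block_grad \<theta> F F' x0"
    using \<open>algorithm_A \<theta> F F' x0 x\<close> by (auto simp: algorithm_A_def)
  have x_Suc: "x (Suc (Suc k)) = x (Suc k)
        - mom_alpha \<theta> F F' (x (Suc k)) (x k) *\<^sub>R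
            ((1 / block_jac_norm2 \<theta> F F' (x (Suc k))) *\<^sub>R block_grad \<theta> F F' (x (Suc k)))
        + mom_beta \<theta> F F' (x (Suc k)) (x k) *\<^sub>R (x (Suc k) - x k)" for k
  proof -
    have "\<forall>k\<ge>1. x (k + 1) = x k
        - mom_alpha \<theta> F F' (x k) (x (k - 1)) *\<^sub>R
            ((1 / block_jac_norm2 \<theta> F F' (x k)) *\<^sub>R block_grad \<theta> F F' (x k))
        + mom_beta \<theta> F F' (x k) (x (k - 1)) *\<^sub>R (x k - x (k - 1))"
      using \<open>algorithm_A \<theta> F F' x0 x\<close> unfolding algorithm_A_def by blast
    from this[rule_format, of "Suc k"] show ?thesis by simp
  qed
  have Delta: "mom_Delta \<theta> F F' (x (Suc k)) (x k) \<noteq> 0" for k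
    using assms(19)[of "Suc k"] by simp
  define \<beta> where "\<beta> = \<beta>max"
  have \<beta>: "0 < \<beta>" "\<beta> < C2 \<eta> \<gamma> K" and K: "1 \<le> K"
    using \<open>\<beta>max \<in> _\<close> \<open>K \<in> _\<close> by (auto simp: \<beta>_def)
  have \<eta>: "0 < \<eta>" "\<eta> < 1/2" by fact+
  have \<gamma>: "3/7 < \<gamma>" "\<gamma> < 1"
    using eps0_bounds[OF \<eta>] \<open>\<gamma> \<in> _\<close> by auto
  define v where "v = 1 / \<gamma> - 1"
  have v: "0 < v" "v \<le> 4/3" "\<gamma> = 1 / (1 + v)"
    using \<gamma> by (auto simp: v_def field_simps)
  define y where "y = \<beta>\<^sup>2 / v"
  have y_eq: "y = \<beta>\<^sup>2 * \<gamma> / (1 - \<gamma>)"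
    using \<gamma> by (simp add: y_def v_def field_simps)
  have "\<beta>\<^sup>2 \<le> 29/200 * v" using momentum_bounds(2)[OF \<eta> v K \<beta>] .
  then have y: "0 < y" "y \<le> 29/200"
    using \<beta> v(1) by (auto simp: y_def pos_divide_le_eq)

  \<comment> \<open>Orthogonality and decay of the steps\<close>
  define u where "u k = x (Suc k) - x k" for k
  define g where "g k = block_grad \<theta> F F' (x k)" for k
  define f where "f k = (norm (block_F \<theta> F (x k)))\<^sup>2" for k
  have u_Suc: "u (Suc k) = mom_beta \<theta> F F' (x (Suc k)) (x k) *\<^sub>R (x (Suc k) - x k)
      - mom_alpha \<theta> F F' (x (Suc k)) (x k) *\<^sub>R
            ((1 / block_jac_norm2 \<theta> F F' (x (Suc k))) *\<^sub>R g (Suc k))" for k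
    unfolding u_def g_def by (simp add: x_Suc)
  have ug: "u (Suc k) \<bullet> g (Suc k) = - f (Suc k)" for k
    using momentum_step(1)[OF Delta[of k]] by (simp add: u_Suc g_def f_def)
  have orth: "(x (Suc (Suc k)) - x (Suc k)) \<bullet> (x (Suc k) - x k) = 0" for k
    using momentum_step(2)[OF Delta[of k]] u_Suc[of k] by (simp add: u_def g_def)
  have contr: "(norm (x (Suc (Suc k)) - x (Suc k)))\<^sup>2 \<le> y * (norm (x (Suc k) - x k))\<^sup>2" for k
  proof -
    have "mom_beta \<theta> F F' (x (Suc k)) (x k) \<in> {0 <..< \<beta>}"
      using cond2[of "Suc k"] by (simp add: \<beta>_def)
    moreover have "(sin (mom_angle \<theta> F F' (x (Suc k)) (x k)))\<^sup>2 \<le> \<gamma>"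
      using cond3[of "Suc k"] by simp
    ultimately show ?thesis
      using momentum_step(3)[OF Delta[of k], of \<beta> \<gamma>] u_Suc[of k] \<gamma>
      by (simp add: u_def g_def y_eq)
  qed

  \<comment> \<open>Uniform cone condition and location of \<open>xs\<close>\<close>
  have cone': "\<bar>F p $ i - F z $ i - F' p $ i \<bullet> (p - z)\<bar> \<le> \<eta> * \<bar>F p $ i - F z $ i\<bar>"
    if "p \<in> cball x0 \<delta>0" "z \<in> cball x0 \<delta>0" for p z i
  proof -
    have "\<eta>c i \<le> \<eta>" unfolding \<open>\<eta> = _\<close> by (intro Max_ge) auto
    then have "\<eta>c i * \<bar>F p $ i - F z $ i\<bar> \<le> \<eta> * \<bar>F p $ i - F z $ i\<bar>" by (rule mult_right_mono) simp
    with cone[OF that, of i] show ?thesis by linarith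
  qed
  have xs: "xs \<in> cball x0 \<delta>0" "F xs = 0"
    using \<open>min_norm_solution D F x0 \<delta>0 xs\<close> by (auto simp: min_norm_solution_def zero_set_def)
  obtain p where p: "p \<in> cball x0 (\<delta>0/4)" "p \<in> zero_set D F"
    using \<open>cball x0 (\<delta>0/4) \<inter> zero_set D F \<noteq> {}\<close> by blast
  have "norm (xs - x0) \<le> norm (p - x0)"
    using p \<open>min_norm_solution D F x0 \<delta>0 xs\<close> \<open>0 < \<delta>0\<close> by (auto simp: min_norm_solution_def)
  with p(1) have xs_near: "xs \<in> cball x0 (\<delta>0/4)"
    by (simp add: dist_norm norm_minus_commute)
  have sub: "cball xs (\<delta>0/2) \<subseteq> cball x0 \<delta>0"
  proof
    fix z assume "z \<in> cball xs (\<delta>0/2)"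
    then show "z \<in> cball x0 \<delta>0"
      using xs_near dist_triangle[of x0 z xs] \<open>0 < \<delta>0\<close> by simp
  qed

  \<comment> \<open>The first step and confinement to the ball\<close>
  define e where "e k = x k - xs" for k
  have e0: "norm (e 0) \<le> \<delta>0/4" using xs_near by (simp add: e_def x_0 dist_norm)
  have e1: "(norm (e 1))\<^sup>2 \<le> (norm (e 0))\<^sup>2"
  proof -
    define t where "t = f 0 / (norm (g 0))\<^sup>2"
    have "(1 - \<eta>) * f 0 \<le> g 0 \<bullet> e 0"
    proof -
      have "(1 - \<eta>) * (F x0 $ i)\<^sup>2 \<le> F x0 $ i * (F' x0 $ i \<bullet> e 0)" for i
      proof -
        have "\<bar>F x0 $ i - F' x0 $ i \<bullet> e 0\<bar> \<le> \<eta> * \<bar>F x0 $ i\<bar>"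
          using cone'[of x0 xs i] xs \<open>0 < \<delta>0\<close> by (simp add: e_def x_0)
        then have "\<bar>F x0 $ i\<bar> * \<bar>F x0 $ i - F' x0 $ i \<bullet> e 0\<bar> \<le> \<bar>F x0 $ i\<bar> * (\<eta> * \<bar>F x0 $ i\<bar>)"
          by (rule mult_left_mono) simp
        also have "\<bar>F x0 $ i\<bar> * (\<eta> * \<bar>F x0 $ i\<bar>) = \<eta> * \<bar>F x0 $ i\<bar>\<^sup>2"
          unfolding power2_eq_square by (rule mult.left_commute)
        finally have "\<bar>F x0 $ i * (F x0 $ i - F' x0 $ i \<bullet> e 0)\<bar> \<le> \<eta> * (F x0 $ i)\<^sup>2"
          by (simp only: abs_mult power2_abs)
        then have "F x0 $ i * (F x0 $ i - F' x0 $ i \<bullet> e 0) \<le> \<eta> * (F x0 $ i)\<^sup>2" by linarith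
        then show ?thesis by (simp add: power2_eq_square algebra_simps)
      qed
      then show ?thesis
        unfolding f_def g_def x_0 norm_block_F block_grad_inner sum_distrib_left by (intro sum_mono)
    qed
    moreover have "0 \<le> f 0" by (simp add: f_def)
    moreover have "0 \<le> (1/2 - \<eta>) * f 0" using \<eta> \<open>0 \<le> f 0\<close> by simp
    ultimately have ge: "f 0 \<le> 2 * (g 0 \<bullet> e 0)" by (simp add: algebra_simps)
    have t: "0 \<le> t" by (simp add: t_def f_def)
    \<comment> \<open>Only an inequality in general: if \<open>g 0 = 0\<close>, division by zero
      gives \<open>t = 0\<close>.\<close>
    have "t * (norm (g 0))\<^sup>2 \<le> f 0" using \<open>0 \<le> f 0\<close> by (simp add: t_def)
    with ge t have "t * (t * (norm (g 0))\<^sup>2) \<le> t * (2 * (g 0 \<bullet> e 0))"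
      by (intro mult_left_mono) auto
    moreover have "e 1 = e 0 - t *\<^sub>R g 0"
      by (simp add: e_def t_def f_def g_def x_0 x_1)
    then have "(norm (e 1))\<^sup>2 = (norm (e 0))\<^sup>2 - t * (2 * (g 0 \<bullet> e 0)) + t * (t * (norm (g 0))\<^sup>2)"
      by (simp add: power2_norm_eq_inner inner_diff_left inner_diff_right inner_commute)
    ultimately show ?thesis by linarith
  qed
  then have e1': "norm (e 1) \<le> norm (e 0)" by simp
  have ball: "x k \<in> cball xs (\<delta>0/2)" for k
  proof -
    \<comment> \<open>The first step does not increase the error, and all later steps together
      displace by at most half of \<open>norm (u 0)\<close>, hence by at most
      \<open>norm (e 0)\<close>.\<close>
    have "norm (e k) \<le> 2 * norm (e 0)"
    proof (cases k)
      case (Suc n)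
      define B where "B = sqrt (1 + y) / (1 - y)"
      have B: "0 \<le> B" "B\<^sup>2 = (1 + y) / (1 - y)\<^sup>2"
        using y by (auto simp: B_def power_divide)
      have "norm (x (1 + n) - x 1) \<le> B * norm (u 1)"
        unfolding B_def u_def using orth contr y by (intro orthogonal_steps_partial) auto
      also have "B * norm (u 1) \<le> 1/2 * norm (u 0)"
      proof (rule power2_le_imp_le)
        have "(B * norm (u 1))\<^sup>2 \<le> B\<^sup>2 * (y * (norm (u 0))\<^sup>2)"
          using contr[of 0] unfolding power_mult_distrib u_def by (intro mult_left_mono) auto
        also have "\<dots> = (B\<^sup>2 * y) * (norm (u 0))\<^sup>2" by simp
        also have "\<dots> \<le> 1/4 * (norm (u 0))\<^sup>2"
        proof (rule mult_right_mono)
          have "(171/200)\<^sup>2 \<le> (1 - y)\<^sup>2" using y by (intro power_mono) auto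
          moreover have "(1 + y) * y \<le> (1 + 29/200) * (29/200)" using y by (intro mult_mono) auto
          ultimately have "4 * ((1 + y) * y) \<le> (1 - y)\<^sup>2" by (simp add: power2_eq_square)
          then show "B\<^sup>2 * y \<le> 1/4" using y by (simp add: B pos_divide_le_eq)
        qed simp
        finally show "(B * norm (u 1))\<^sup>2 \<le> (1/2 * norm (u 0))\<^sup>2"
          by (simp add: power_mult_distrib power_divide)
      qed simp
      also have "norm (u 0) \<le> norm (e 1) + norm (e 0)"
        using norm_triangle_ineq4[of "e 1" "e 0"] by (simp add: u_def e_def)
      finally have "norm (x (1 + n) - x 1) \<le> norm (e 0)" using e1' by simp
      moreover have "e k = e 1 + (x (1 + n) - x 1)" by (simp add: e_def Suc)
      ultimately show ?thesis using e1' norm_triangle_ineq[of "e 1" "x (1 + n) - x 1"] by simp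
    qed simp
    then show ?thesis using e0 by (simp add: e_def dist_norm norm_minus_commute)
  qed

  \<comment> \<open>Orthogonality of all errors to the null space\<close>
  define N where "N = null_space (F' xs)"
  have e_N: "w \<bullet> e k = 0" if w: "w \<in> N" for w k
  proof -
    \<comment> \<open>The kernel inclusion applies because every iterate is already known to lie in
      the ball.\<close>
    have gN: "w \<bullet> g j = 0" for j
    proof -
      have "w \<in> null_space (F' (x j))"
        using w assms(15)[OF ball[of j]] by (auto simp: N_def)
      then have "F' (x j) $ i \<bullet> w = 0" for i
        by (metis (mono_tags) matrix_vector_mul_component mem_Collect_eq null_space_def zero_index)
      then have "g j \<bullet> w = 0" by (simp add: g_def block_grad_inner)
      then show ?thesis by (simp add: inner_commute)
    qed
    have uN: "w \<bullet> u j = 0" for j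
    proof (induction j)
      case 0
      then show ?case using gN[of 0] by (simp add: u_def x_1 x_0 g_def)
    next
      case (Suc j)
      then show ?case using gN[of "Suc j"] by (simp add: u_Suc inner_diff_right) (simp add: u_def inner_diff_right)
    qed
    show ?thesis
    proof (induction k)
      case 0
      show ?case unfolding e_def x_0
        using cone' xs(1) xs_near \<open>0 < \<delta>0\<close> \<open>cball x0 \<delta>0 \<subseteq> D\<close> \<eta> w
          \<open>min_norm_solution D F x0 \<delta>0 xs\<close>
        by (intro min_norm_solution_orthogonal[of \<delta>0 x0 D F xs F' \<eta> w]) (auto simp: N_def)
    next
      case (Suc k)
      have "e (Suc k) = e k + u k" by (simp add: e_def u_def)
      then show ?case using Suc uN[of k] by (simp add: inner_add_right)
    qed
  qed

  \<comment> \<open>Convergence to the minimum-norm solution\<close>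
  have lim: "x \<longlonglongrightarrow> xs"
  proof -
    have "Cauchy x" and u0: "u \<longlonglongrightarrow> 0"
      unfolding u_def using orthogonal_steps_Cauchy[of x y, OF orth contr] y by auto
    then obtain a where a: "x \<longlonglongrightarrow> a" by (auto simp: Cauchy_convergent_iff convergent_def)
    have aB: "a \<in> cball xs (\<delta>0/2)"
      using ball by (intro closed_sequentially[OF closed_cball _ a]) auto
    then have a0: "a \<in> cball x0 \<delta>0" using sub by blast
    have cont: "continuous_on (cball x0 \<delta>0) (\<lambda>z. F z $ i)" for i
      unfolding continuous_on_eq_continuous_within
      using differentiable \<open>cball x0 \<delta>0 \<subseteq> D\<close>
      by (meson has_derivative_continuous has_derivative_subset subsetD)
    have "\<exists>M. \<forall>z \<in> cball x0 \<delta>0. \<bar>F z $ i\<bar> \<le> M" for i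
      using compact_imp_bounded[OF compact_continuous_image[OF cont compact_cball], of i]
      by (auto simp: bounded_iff)
    then obtain m where m: "\<And>i z. z \<in> cball x0 \<delta>0 \<Longrightarrow> \<bar>F z $ i\<bar> \<le> m i" by metis
    define M where "M = (\<Sum>i\<in>UNIV. m i)"
    have m0: "0 \<le> m i" for i using m[OF xs(1), of i] by linarith
    have M: "\<bar>F z $ i\<bar> \<le> M" if "z \<in> cball x0 \<delta>0" for i z
      using m[OF that, of i] member_le_sum[of i UNIV m] m0 by (auto simp: M_def)
    have M0: "0 \<le> M" unfolding M_def by (intro sum_nonneg m0)
    \<comment> \<open>The Jacobian need not be continuous, so the gradients are bounded through the
      cone condition: it controls the derivative along \<open>g k\<close> by values of F. The 16 is
      4 from \<open>4 * M\<close> times 4 from the step \<open>\<delta>0/4\<close>.\<close>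
    define G where "G = CARD('m) * (M * (16 * M / \<delta>0))"
    have G0: "0 \<le> G" using M0 \<open>0 < \<delta>0\<close> by (simp add: G_def)
    have gG: "norm (g k) \<le> G" for k
    proof (cases "g k = 0")
      case False
      define t where "t = (\<delta>0/4) / norm (g k)"
      have t: "0 < t" using False \<open>0 < \<delta>0\<close> by (simp add: t_def)
      \<comment> \<open>The test point stays in the ball since
        \<open>\<delta>0/4 + \<delta>0/2 + \<delta>0/4 = \<delta>0\<close>.\<close>
      define z where "z = x k - t *\<^sub>R g k"
      have "dist (x k) z = \<delta>0/4" using \<open>0 < \<delta>0\<close> False by (simp add: z_def dist_norm t_def)
      moreover have "dist x0 (x k) \<le> dist x0 xs + dist xs (x k)" by (rule dist_triangle)
      ultimately have z: "z \<in> cball x0 \<delta>0"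
        using dist_triangle[of x0 z "x k"] xs_near ball[of k] by simp
      have xk: "x k \<in> cball x0 \<delta>0" using ball sub by blast
      have row: "\<bar>F' (x k) $ i \<bullet> g k\<bar> \<le> norm (g k) * (16 * M / \<delta>0)" for i
      proof -
        have "\<bar>F (x k) $ i - F z $ i - t * (F' (x k) $ i \<bullet> g k)\<bar> \<le> \<eta> * \<bar>F (x k) $ i - F z $ i\<bar>"
          using cone'[OF xk z, of i] by (simp add: z_def)
        also have "\<dots> \<le> \<bar>F (x k) $ i - F z $ i\<bar>"
          using \<eta> by (intro mult_left_le_one_le) auto
        finally have "\<bar>F (x k) $ i - F z $ i - t * (F' (x k) $ i \<bullet> g k)\<bar> \<le> \<bar>F (x k) $ i - F z $ i\<bar>" .
        moreover have "\<bar>c\<bar> \<le> 4 * M" if "\<bar>a - b - c\<bar> \<le> \<bar>a - b\<bar>" "\<bar>a\<bar> \<le> M" "\<bar>b\<bar> \<le> M" for a b c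
          using that by linarith
        ultimately have "\<bar>t * (F' (x k) $ i \<bullet> g k)\<bar> \<le> 4 * M"
          using M[OF xk, of i] M[OF z, of i] by blast
        then have "t * \<bar>F' (x k) $ i \<bullet> g k\<bar> \<le> 4 * M" using t by (simp add: abs_mult)
        then show ?thesis using False \<open>0 < \<delta>0\<close> by (simp add: t_def field_simps)
      qed
      have "(norm (g k))\<^sup>2 = g k \<bullet> g k" by (rule power2_norm_eq_inner)
      also have "\<dots> = (\<Sum>i\<in>block_set \<theta> F (x k). F (x k) $ i * (F' (x k) $ i \<bullet> g k))"
        by (subst g_def) (rule block_grad_inner)
      also have "\<dots> \<le> (\<Sum>i\<in>block_set \<theta> F (x k). M * (norm (g k) * (16 * M / \<delta>0)))"
      proof (rule sum_mono)
        fix i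
        have "\<bar>F (x k) $ i\<bar> * \<bar>F' (x k) $ i \<bullet> g k\<bar> \<le> M * (norm (g k) * (16 * M / \<delta>0))"
          using M[OF xk] row M0 by (intro mult_mono) auto
        then show "F (x k) $ i * (F' (x k) $ i \<bullet> g k) \<le> M * (norm (g k) * (16 * M / \<delta>0))"
          unfolding abs_mult[symmetric] by (rule order_trans[OF abs_ge_self])
      qed
      also have "\<dots> \<le> (\<Sum>i\<in>(UNIV :: 'm set). M * (norm (g k) * (16 * M / \<delta>0)))"
        using M0 \<open>0 < \<delta>0\<close> by (intro sum_mono2) auto
      also have "\<dots> = G * norm (g k)" by (simp add: G_def)
      finally show ?thesis using False by (simp add: power2_eq_square)
    qed (simp add: G0)
    \<comment> \<open>Up to sign \<open>f\<close> is the inner product of a vanishing step with a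
      bounded gradient.\<close>
    have f0: "(\<lambda>k. f (Suc k)) \<longlonglongrightarrow> 0"
    proof (rule Lim_null_comparison)
      have "norm (f (Suc k)) \<le> norm (u (Suc k)) * G" for k
      proof -
        have "norm (f (Suc k)) = \<bar>u (Suc k) \<bullet> g (Suc k)\<bar>" by (simp add: ug)
        also have "\<dots> \<le> norm (u (Suc k)) * norm (g (Suc k))" by (rule Cauchy_Schwarz_ineq2)
        also have "\<dots> \<le> norm (u (Suc k)) * G" by (intro mult_left_mono gG) simp
        finally show ?thesis .
      qed
      then show "\<forall>\<^sub>F k in sequentially. norm (f (Suc k)) \<le> norm (u (Suc k)) * G" by simp
      show "(\<lambda>k. norm (u (Suc k)) * G) \<longlonglongrightarrow> 0"
        using u0 by (intro tendsto_mult_left_zero tendsto_norm_zero LIMSEQ_Suc)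
    qed
    have "F a $ i = 0" for i
    proof -
      have "(\<lambda>k. F (x k) $ i) \<longlonglongrightarrow> F a $ i"
        using ball sub by (intro continuous_on_tendsto_compose[OF cont a a0] always_eventually) blast
      then have 1: "(\<lambda>k. (F (x (Suc k)) $ i)\<^sup>2) \<longlonglongrightarrow> (F a $ i)\<^sup>2"
        by (intro tendsto_power LIMSEQ_Suc)
      have "(\<lambda>k. (F (x (Suc k)) $ i)\<^sup>2) \<longlonglongrightarrow> 0"
        by (intro Lim_null_comparison[OF _ f0])
          (simp add: f_def component_le_norm_block_F[OF \<open>\<theta> \<le> 1\<close>])
      with 1 have "(F a $ i)\<^sup>2 = 0" by (rule LIMSEQ_unique)
      then show ?thesis by simp
    qed
    \<comment> \<open>With F zero at both points the cone condition puts \<open>a - xs\<close> into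
      \<open>N\<close>. As a limit of errors it is also orthogonal to \<open>N\<close>, hence to
      itself.\<close>
    then have "F' xs $ i \<bullet> (xs - a) = 0" for i
      using cone'[OF xs(1) a0, of i] by (simp add: xs(2))
    then have "a - xs \<in> N"
      by (simp add: N_def null_space_def vec_eq_iff matrix_vector_mul_component inner_diff_right)
    moreover have "(\<lambda>k. (a - xs) \<bullet> e k) \<longlonglongrightarrow> (a - xs) \<bullet> (a - xs)"
      unfolding e_def by (intro tendsto_intros a)
    ultimately have "(a - xs) \<bullet> (a - xs) = 0"
      using e_N by (simp add: LIMSEQ_const_iff)
    then show ?thesis using a by simp
  qed

  \<comment> \<open>The convergence rate\<close>
  define q where "q = q_rate \<eta> \<gamma> K \<beta>"
  have q: "y * (1 + y) / (1 - y)^3 \<le> q"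
    unfolding q_def y_def by (rule tail_rate_le_q_rate[OF \<eta> v K \<beta>])
  then have q0: "0 \<le> q" using y by (auto intro: order_trans[rotated])
  \<comment> \<open>The first step contributes no factor q, so the exponent is one less than the
    index of the error.\<close>
  have bound: "(norm (e (Suc k)))\<^sup>2 \<le> q ^ k * (norm (e 0))\<^sup>2" for k
  proof (induction k)
    case 0
    then show ?case using e1 by simp
  next
    case (Suc k)
    have "(norm (e (Suc (Suc k))))\<^sup>2 \<le> y * (1 + y) / (1 - y)^3 * (norm (e (Suc k)))\<^sup>2"
      unfolding e_def using orth contr y lim by (rule orthogonal_steps_tail)
    also have "\<dots> \<le> q * (norm (e (Suc k)))\<^sup>2" using q by (intro mult_right_mono) auto
    also have "\<dots> \<le> q * (q ^ k * (norm (e 0))\<^sup>2)" using Suc q0 by (intro mult_left_mono)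
    finally show ?case by (simp add: mult_ac)
  qed
  have "(norm (x (k + 1) - xs))\<^sup>2 \<le> q ^ k * (1 + xi \<eta> \<gamma> K \<beta>) * (norm (x0 - xs))\<^sup>2" for k
  proof -
    have "q ^ k * 1 * (norm (e 0))\<^sup>2 \<le> q ^ k * (1 + xi \<eta> \<gamma> K \<beta>) * (norm (e 0))\<^sup>2"
      using xi_nonneg[OF \<beta>(1)] q0 by (intro mult_right_mono mult_left_mono) auto
    with bound[of k] show ?thesis by (simp add: e_def x_0)
  qed
  moreover have "x (k + 1) - xs \<in> orthogonal_comp (null_space (F' xs))" for k
    using e_N[of _ "Suc k"] by (simp add: orthogonal_comp_def orthogonal_def N_def e_def)
  ultimately show ?thesis
    using ball sub q_rate_less_d[OF \<eta> \<beta>] unfolding q_def \<beta>_def by blast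
qed

end
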